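(* Let $0<\epsilon<1$, let $n\ge3$ be an odd integer and $k:=\frac{n-3}{2}$. Let $f\in C_c^\infty(\mathbb{B})$ be radial, where $\mathbb{B}$ is the unit ball in $\mathbb{R}^n$, write $f(x)=f(|x|)$, and let $$h_k(t)=\frac{4^k\omega_{2k+3}\,t^{2k+1}}{\omega_{2k+2}}\,\mathcal{R}f(p,t),\qquad (p,t)\in\mathbb{S}^{n-1}\times(0,1).$$ Then $f$ can be recovered from $h_k$ in the annular region $\mathbb{B}(\epsilon,1)$ by solving the linear ordinary differential equation $$\left[\frac{d}{dt}D^{2k}h_k\right](t)=\frac{(-1)^k k!\,2^{3k}}{t^{2k}}\left[\mathcal{L}_k\left(t^{2k+1}f\right)\right](1-t)$$ with initial conditions $f^{(i)}(1-\epsilon')=0$ for $0\le i\le k-1$, where $\epsilon'>0$ is small enough that $1-\epsilon'>\epsilon$ and $f(r)=0$ for all $r\ge 1-\epsilon'$. That is, the radial profile $f$ satisfies this equation for all $t\in(0,1-\epsilon)$ together with these initial conditions, and its restriction to $(\epsilon,1)$ is the only $k$ times continuously differentiable function on $(\epsilon,1)$ that does so (with $h_k$ given).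
   Context: $\mathbb{B}$ is the open unit ball in $\mathbb{R}^n$, $\mathbb{B}(\epsilon,1)=\{x\in\mathbb{R}^n:\epsilon<|x|<1\}$, and $\omega_j$ denotes here the surface area of the unit sphere in $\mathbb{R}^j$. The spherical mean transform of $f$ (extended by zero to $\mathbb{R}^n$) is $$\mathcal{R}f(p,t)=\frac{1}{|\mathbb{S}^{n-1}|}\int_{\mathbb{S}^{n-1}}f(p+t\theta)\,dS(\theta),\qquad (p,t)\in\mathbb{S}^{n-1}\times(0,2),$$ where $|\mathbb{S}^{n-1}|$ is the surface area of the unit sphere and $dS$ the surface measure; for radial $f$ it does not depend on $p$. For an integer $k\ge0$, $$\mathcal{L}_k=\sum_{l=0}^k\frac{(k+l)!}{(k-l)!\,l!\,2^l}(1-t)^{k-l}D^{k-l},\qquad D=\frac1t\frac{d}{dt},\quad D^0=\mathrm{id},$$ and $[\mathcal{L}_kF](s)$ denotes the value of the function $\mathcal{L}_kF$ at the point $s$ (so the coefficient becomes $(1-s)^{k-l}$). In the equation $\mathcal{L}_k$ is applied to the function $r\mapsto r^{2k+1}f(r)$ and the result is evaluated at $r=1-t$. *)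

theory Defs
  imports "HOL-Analysis.Analysis"
begin

text \<open>
  The surface measure of the unit sphere, defined by the cone construction: a Borel set \<open>A\<close> of
  directions has surface area \<open>n\<close> times the Lebesgue measure of \<open>{r *\<^sub>R \<theta> | 0 < r < 1, \<theta> \<in> A}\<close>
  (integration in polar coordinates); see \<open>emeasure_sphere_measure\<close> below.
\<close>

definition sphere_measure :: "'a::euclidean_space measure" where
  "sphere_measure =
     scale_measure (of_nat DIM('a))
       (distr (restrict_space lborel (ball 0 1 - {0})) (restrict_space borel (sphere 0 1)) sgn)"

text \<open>
  \<open>sphere_area j\<close> is the surface area of the unit sphere in \<open>j\<close>-dimensional Euclidean space.  It is
  given by a formula in \<open>j\<close> because areas for two different dimensions are needed;
  \<open>measure_sphere_measure\<close> shows that it is the total mass of the surface measure.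
\<close>

definition sphere_area :: "nat \<Rightarrow> real" where
  "sphere_area j = real j * unit_ball_vol (real j)"

definition spherical_mean :: "('a::euclidean_space \<Rightarrow> real) \<Rightarrow> 'a \<Rightarrow> real \<Rightarrow> real" where
  "spherical_mean f p t =
     1 / measure (sphere_measure :: 'a measure) (sphere 0 1) *
       (\<integral>\<theta>. f (p + t *\<^sub>R \<theta>) \<partial>sphere_measure)"

primrec C_k :: "nat \<Rightarrow> ('a::euclidean_space \<Rightarrow> real) \<Rightarrow> bool" where
  "C_k 0 f \<longleftrightarrow> continuous_on UNIV f"
| "C_k (Suc m) f \<longleftrightarrow>
     f differentiable_on UNIV \<and> (\<forall>v\<in>Basis. C_k m (\<lambda>x. frechet_derivative f (at x) v))"

text \<open>Functions in \<open>C\<^sub>c\<^sup>\<infinity>(U)\<close>, \<open>U\<close> open, are identified with their extensions by zero.\<close>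

definition test_function_on :: "'a::euclidean_space set \<Rightarrow> ('a \<Rightarrow> real) \<Rightarrow> bool" where
  "test_function_on U f \<longleftrightarrow>
     (\<forall>m. C_k m f) \<and> compact (closure {x. f x \<noteq> 0}) \<and> closure {x. f x \<noteq> 0} \<subseteq> U"

text \<open>\<open>m\<close> times continuously differentiable functions of one variable on an open set \<open>S\<close>.\<close>

definition C_k_on :: "nat \<Rightarrow> real set \<Rightarrow> (real \<Rightarrow> real) \<Rightarrow> bool" where
  "C_k_on m S g \<longleftrightarrow>
     (\<forall>i<m. \<forall>x\<in>S. (deriv ^^ i) g field_differentiable at x) \<and> continuous_on S ((deriv ^^ m) g)"

definition D_op :: "(real \<Rightarrow> real) \<Rightarrow> real \<Rightarrow> real" where
  "D_op F t = 1 / t * deriv F t"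

definition L_op :: "nat \<Rightarrow> (real \<Rightarrow> real) \<Rightarrow> real \<Rightarrow> real" where
  "L_op k F s =
     (\<Sum>l=0..k. fact (k + l) / (fact (k - l) * fact l * 2 ^ l) *
        (1 - s) ^ (k - l) * (D_op ^^ (k - l)) F s)"

definition solves_ivp ::
  "nat \<Rightarrow> (real \<Rightarrow> real) \<Rightarrow> real \<Rightarrow> real \<Rightarrow> (real \<Rightarrow> real) \<Rightarrow> bool" where
  "solves_ivp k h \<epsilon> \<epsilon>' g \<longleftrightarrow>
     C_k_on k {\<epsilon><..<1} g \<and>
     (\<forall>t\<in>{0<..<1 - \<epsilon>}.
        deriv ((D_op ^^ (2 * k)) h) t =
          (-1) ^ k * fact k * 2 ^ (3 * k) / t ^ (2 * k) *
            L_op k (\<lambda>r. r ^ (2 * k + 1) * g r) (1 - t)) \<and>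
     (\<forall>i<k. (deriv ^^ i) g (1 - \<epsilon>') = 0)"

lemma sgn_measurable_sphere:
  "sgn \<in> restrict_space lborel (ball 0 1 - {0}) \<rightarrow>\<^sub>M
           restrict_space borel (sphere (0::'a::euclidean_space) 1)"
proof (rule measurable_restrict_space2)
  show "sgn \<in> space (restrict_space lborel (ball 0 1 - {0})) \<rightarrow> sphere (0::'a) 1"
    by (auto simp: space_restrict_space norm_sgn)
  have "(\<lambda>x::'a. x /\<^sub>R norm x) \<in> borel_measurable borel"
    by measurable
  then show "(sgn :: 'a \<Rightarrow> 'a) \<in> borel_measurable (restrict_space lborel (ball 0 1 - {0}))"
    by (intro measurable_restrict_space1) (simp add: sgn_div_norm[abs_def])
qed

lemma sets_sphere_measure [simp]:
  "sets (sphere_measure :: 'a::euclidean_space measure) = sets (restrict_space borel (sphere 0 1))"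
  by (simp add: sphere_measure_def)

lemma space_sphere_measure [simp]:
  "space (sphere_measure :: 'a::euclidean_space measure) = sphere 0 1"
  using sets_eq_imp_space_eq[OF sets_sphere_measure] by (simp add: space_restrict_space)

lemma emeasure_sphere_measure:
  fixes A :: "'a::euclidean_space set"
  assumes "A \<in> sets borel" "A \<subseteq> sphere 0 1"
  shows "emeasure sphere_measure A =
           of_nat DIM('a) * emeasure lborel {r *\<^sub>R \<theta> | r \<theta>. 0 < r \<and> r < 1 \<and> \<theta> \<in> A}"
proof -
  let ?B = "ball 0 1 - {0} :: 'a set"
  have A: "A \<in> sets (restrict_space borel (sphere (0::'a) 1))"
    using assms by (auto simp: sets_restrict_space_iff)
  have cone: "sgn -` A \<inter> ?B = {r *\<^sub>R \<theta> | r \<theta>. 0 < r \<and> r < 1 \<and> \<theta> \<in> A}"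
  proof (intro equalityI subsetI)
    fix x assume "x \<in> sgn -` A \<inter> ?B"
    then have "x = norm x *\<^sub>R sgn x" "0 < norm x" "norm x < 1" "sgn x \<in> A"
      by (auto simp: sgn_div_norm)
    then show "x \<in> {r *\<^sub>R \<theta> | r \<theta>. 0 < r \<and> r < 1 \<and> \<theta> \<in> A}"
      by blast
  next
    fix x assume "x \<in> {r *\<^sub>R \<theta> | r \<theta>. 0 < r \<and> r < 1 \<and> \<theta> \<in> A}"
    then obtain r \<theta> where x: "x = r *\<^sub>R \<theta>" "0 < r" "r < 1" "\<theta> \<in> A"
      by blast
    moreover have "norm \<theta> = 1"
      using x assms(2) by auto
    ultimately show "x \<in> sgn -` A \<inter> ?B"
      by (auto simp: sgn_div_norm)
  qed
  have "emeasure sphere_measure A =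
          of_nat DIM('a) * emeasure (restrict_space lborel ?B) (sgn -` A \<inter> ?B)"
    using A by (simp add: sphere_measure_def emeasure_distr[OF sgn_measurable_sphere]
        space_restrict_space)
  also have "emeasure (restrict_space lborel ?B) (sgn -` A \<inter> ?B) =
               emeasure lborel (sgn -` A \<inter> ?B)"
    by (intro emeasure_restrict_space) auto
  finally show ?thesis
    by (simp add: cone)
qed

lemma measure_sphere_measure:
  "measure (sphere_measure :: 'a::euclidean_space measure) (sphere 0 1) = sphere_area DIM('a)"
proof -
  have eq: "{r *\<^sub>R \<theta> | r \<theta>. 0 < r \<and> r < 1 \<and> \<theta> \<in> sphere 0 1} = ball (0::'a) 1 - {0}"
  proof (intro equalityI subsetI)
    fix x :: 'a assume "x \<in> ball 0 1 - {0}"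
    then have "x = norm x *\<^sub>R sgn x" "0 < norm x" "norm x < 1" "sgn x \<in> sphere 0 1"
      by (auto simp: sgn_div_norm)
    then show "x \<in> {r *\<^sub>R \<theta> | r \<theta>. 0 < r \<and> r < 1 \<and> \<theta> \<in> sphere 0 1}"
      by blast
  qed auto
  have "emeasure lborel (ball (0::'a) 1 - {0}) = emeasure lborel (ball (0::'a) 1)"
    by (intro emeasure_Diff_null_set) auto
  then have "emeasure (sphere_measure :: 'a measure) (sphere 0 1) = ennreal (sphere_area DIM('a))"
    by (subst emeasure_sphere_measure, simp, simp, subst eq)
      (simp add: emeasure_ball sphere_area_def ennreal_of_nat_eq_real_of_nat ennreal_mult)
  then show ?thesis
    by (simp add: measure_def sphere_area_def)
qed

end

theory Submission
  imports Defs
begin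

text \<open>
  Write \<open>n = 2 k + 3\<close> and \<open>D = (1 / t) d/dt\<close>. Three ingredients give the equation.

  First, for a radial function \<open>f x = \<phi> (norm x)\<close> the integrand of the spherical mean at the unit
  vector \<open>p\<close> depends on the direction \<open>\<theta>\<close> only through \<open>s = \<theta> \<bullet> p\<close>, because
  \<open>norm (p + t *\<^sub>R \<theta>)\<close> is the square root of \<open>1 + t\<^sup>2 + 2 * t * s\<close>. The image of the surface
  measure under \<open>\<theta> \<mapsto> \<theta> \<bullet> p\<close> has density \<open>(1 - s\<^sup>2) ^ k\<close> on \<open>[-1, 1]\<close>, up to the constant
  \<open>sphere_area (2 * k + 2)\<close> (\<open>integral_sphere_cos\<close>). Taking the distance \<open>r\<close> as the variable of
  integration turns \<open>h\<close> into
  \<open>K\<^sub>k[q](t) = \<integral> q r * P(r, t) ^ k dr\<close> over \<open>[1 - t, 1]\<close>, where \<open>q r = r * \<phi> r\<close> and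
  \<open>P(r, t) = 4 * t\<^sup>2 - (r\<^sup>2 - 1 - t\<^sup>2)\<^sup>2\<close> (\<open>spherical_mean_radial_conv_kernel_integral\<close>); the upper
  limit is \<open>1\<close> because \<open>\<phi>\<close> vanishes beyond it.

  Secondly, \<open>P\<close> vanishes at \<open>r = 1 - t\<close> and satisfies \<open>(D P)\<^sup>2 = 64 r\<^sup>2 - 16 P\<close> and \<open>D\<^sup>2 P = - 8\<close>.
  Therefore \<open>D\<^sup>2 K\<^sub>k[q] = 64 k (k - 1) K\<^sub>k\<^sub>-\<^sub>2[r\<^sup>2 q] - 8 k (2 k - 1) K\<^sub>k\<^sub>-\<^sub>1[q]\<close> for \<open>k \<ge> 2\<close>
  (\<open>D_op_D_op_kernel_integral\<close>).

  Thirdly, the coefficients of \<open>L\<^sub>k\<close> are those of the reverse Bessel polynomials. Their classical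
  relations imply for \<open>W\<^sub>k[G](t) = L\<^sub>k G (1 - t) / t ^ (2 * k + 1)\<close> the matching recursion
  \<open>W\<^sub>k[r\<^sup>2 G] = D\<^sup>2 W\<^sub>k\<^sub>-\<^sub>2[G] + (2 k - 1) W\<^sub>k\<^sub>-\<^sub>1[G]\<close> (\<open>scaled_L_recurrence\<close>). Induction in steps of
  two yields \<open>D\<^sup>2\<^sup>k\<^sup>+\<^sup>1 K\<^sub>k[q] = (-1)\<^sup>k k! 8\<^sup>k W\<^sub>k[r\<^sup>2\<^sup>k q]\<close> (\<open>D_op_funpow_kernel_integral\<close>), which is
  the asserted equation divided by \<open>t\<close>.

  Uniqueness holds because, at the point \<open>s = 1 - t\<close>, the equation is a linear ordinary differential
  equation of order \<open>k\<close> whose leading coefficient does not vanish on \<open>(\<epsilon>, 1)\<close>; the difference of two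
  solutions has vanishing initial data and is zero by Gronwall's inequality (\<open>L_op_ivp_unique\<close>).
\<close>

section \<open>Continuously differentiable functions of one variable\<close>

lemma C_k_on_0: "C_k_on 0 S g \<longleftrightarrow> continuous_on S g"
  by (simp add: C_k_on_def)

lemma C_k_on_Suc:
  "C_k_on (Suc m) S g \<longleftrightarrow> (\<forall>x\<in>S. g field_differentiable at x) \<and> C_k_on m S (deriv g)"
proof -
  have "(deriv ^^ Suc i) g = (deriv ^^ i) (deriv g)" for i
    by (simp only: funpow_Suc_right o_apply)
  then show ?thesis
    unfolding C_k_on_def by (simp only: All_less_Suc2 funpow_0) auto
qed

text \<open>
  Since \<open>deriv\<close> is a total function, \<open>C_k_on\<close> depends only on the values of the function on the open
  set, so derivatives may be replaced by any expression that represents them there.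
\<close>
lemma C_k_on_cong:
  assumes "open S" "\<And>x. x \<in> S \<Longrightarrow> f x = g x"
  shows "C_k_on m S f \<longleftrightarrow> C_k_on m S g"
  using assms(2)
proof (induction m arbitrary: f g)
  case 0
  then show ?case by (simp add: C_k_on_0 cong: continuous_on_cong)
next
  case (Suc m)
  have ev: "\<forall>\<^sub>F y in nhds x. f y = g y" if "x \<in> S" for x
    using Suc.prems that assms(1) by (auto simp: eventually_nhds)
  have "f field_differentiable at x \<longleftrightarrow> g field_differentiable at x" if "x \<in> S" for x
    unfolding field_differentiable_def
    using DERIV_cong_ev[OF refl ev[OF that] refl] by simp
  moreover have "deriv f x = deriv g x" if "x \<in> S" for x
    by (rule deriv_cong_ev[OF ev[OF that] refl])
  ultimately show ?case
    by (simp add: C_k_on_Suc Suc.IH[of "deriv f" "deriv g"])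
qed

lemma C_k_on_Suc_if_derivative:
  assumes "open S" and "\<And>x. x \<in> S \<Longrightarrow> (g has_real_derivative g' x) (at x)" and "C_k_on m S g'"
  shows "C_k_on (Suc m) S g"
proof -
  have "deriv g x = g' x" if "x \<in> S" for x
    using assms(2)[OF that] by (rule DERIV_imp_deriv)
  then have "C_k_on m S (deriv g)"
    using C_k_on_cong[OF assms(1)] assms(3) by blast
  then show ?thesis
    using assms(2) by (auto simp: C_k_on_Suc field_differentiable_def)
qed

lemma C_k_on_subset: "C_k_on m S g \<Longrightarrow> T \<subseteq> S \<Longrightarrow> C_k_on m T g"
  unfolding C_k_on_def by (meson continuous_on_subset subsetD)

lemma C_k_on_DERIV:
  "C_k_on (Suc m) S g \<Longrightarrow> x \<in> S \<Longrightarrow> (g has_real_derivative deriv g x) (at x)"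
  by (simp add: C_k_on_Suc DERIV_deriv_iff_field_differentiable)

lemma C_k_on_SucD: "C_k_on (Suc m) S g \<Longrightarrow> C_k_on m S g"
proof (induction m arbitrary: g)
  case 0
  then show ?case
    by (auto simp: C_k_on_Suc C_k_on_0 intro!: continuous_at_imp_continuous_on
        field_differentiable_imp_continuous_at)
next
  case (Suc m)
  then show ?case by (metis C_k_on_Suc)
qed

lemma C_k_on_le: "C_k_on m S g \<Longrightarrow> j \<le> m \<Longrightarrow> C_k_on j S g"
  by (induction m) (auto simp: le_Suc_eq dest: C_k_on_SucD)

lemma C_k_on_continuous: "C_k_on m S g \<Longrightarrow> continuous_on S g"
  using C_k_on_le[of m S g 0] by (simp add: C_k_on_0)

lemma C_k_on_const [simp]: "open S \<Longrightarrow> C_k_on m S (\<lambda>x. c)"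
  by (induction m arbitrary: c)
    (auto simp: C_k_on_0 intro!: C_k_on_Suc_if_derivative[where g' = "\<lambda>x. 0"])

lemma C_k_on_ident [simp]: "open S \<Longrightarrow> C_k_on m S (\<lambda>x. x)"
  by (cases m) (auto simp: C_k_on_0 intro!: C_k_on_Suc_if_derivative[where g' = "\<lambda>x. 1"])

lemma C_k_on_add:
  "open S \<Longrightarrow> C_k_on m S f \<Longrightarrow> C_k_on m S g \<Longrightarrow> C_k_on m S (\<lambda>x. f x + g x)"
proof (induction m arbitrary: f g)
  case 0
  then show ?case by (simp add: C_k_on_0 continuous_on_add)
next
  case (Suc m)
  show ?case
    by (rule C_k_on_Suc_if_derivative[where g' = "\<lambda>x. deriv f x + deriv g x"])
      (use Suc in \<open>auto intro!: DERIV_add C_k_on_DERIV simp: C_k_on_Suc[of _ S f]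
          C_k_on_Suc[of _ S g]
         DERIV_deriv_iff_field_differentiable\<close>)
qed

lemma C_k_on_mult:
  "open S \<Longrightarrow> C_k_on m S f \<Longrightarrow> C_k_on m S g \<Longrightarrow> C_k_on m S (\<lambda>x. f x * g x)"
proof (induction m arbitrary: f g)
  case 0
  then show ?case by (simp add: C_k_on_0 continuous_on_mult)
next
  case (Suc m)
  have "C_k_on m S (\<lambda>x. deriv f x * g x + deriv g x * f x)"
    using Suc C_k_on_SucD by (intro C_k_on_add Suc.IH) (auto simp: C_k_on_Suc dest: C_k_on_SucD)
  then show ?case
    using Suc.prems
    by (intro C_k_on_Suc_if_derivative[where g' = "\<lambda>x. deriv f x * g x + deriv g x * f x"])
      (auto intro!: DERIV_mult C_k_on_DERIV)
qed

lemma C_k_on_diff: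
  assumes "open S" "C_k_on m S f" "C_k_on m S g"
  shows "C_k_on m S (\<lambda>x. f x - g x)"
proof -
  have "C_k_on m S (\<lambda>x. f x + (-1) * g x)"
    by (intro C_k_on_add C_k_on_mult C_k_on_const assms)
  then show ?thesis by simp
qed

lemma C_k_on_power: "open S \<Longrightarrow> C_k_on m S f \<Longrightarrow> C_k_on m S (\<lambda>x. f x ^ j)"
  by (induction j) (auto intro: C_k_on_mult)

lemma C_k_on_sum:
  assumes "open S" "\<And>i. i \<in> I \<Longrightarrow> C_k_on m S (f i)"
  shows "C_k_on m S (\<lambda>x. \<Sum>i\<in>I. f i x)"
  using assms(2) by (induction I rule: infinite_finite_induct)
      (auto intro: C_k_on_add simp: assms(1))

lemma C_k_on_inverse:
  "open S \<Longrightarrow> C_k_on m S f \<Longrightarrow> (\<And>x. x \<in> S \<Longrightarrow> f x \<noteq> 0) \<Longrightarrow> C_k_on m S (\<lambda>x. inverse (f x))"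
proof (induction m)
  case 0
  then show ?case by (auto simp: C_k_on_0 intro: continuous_on_inverse)
next
  case (Suc m)
  have inv: "C_k_on m S (\<lambda>x. inverse (f x))"
    using Suc C_k_on_SucD by blast
  have "C_k_on m S (\<lambda>x. (-1) * (inverse (f x) * deriv f x * inverse (f x)))"
    using Suc.prems inv by (intro C_k_on_mult) (auto simp: C_k_on_Suc)
  moreover have "((\<lambda>x. inverse (f x)) has_real_derivative
      (-1) * (inverse (f x) * deriv f x * inverse (f x))) (at x)" if "x \<in> S" for x
    using DERIV_inverse'[OF C_k_on_DERIV[OF Suc.prems(2) that] Suc.prems(3)[OF that]] by simp
  ultimately show ?case
    by (intro C_k_on_Suc_if_derivative[OF Suc.prems(1)])
qed

lemma C_k_on_divide:
  assumes "open S" "C_k_on m S f" "C_k_on m S g" "\<And>x. x \<in> S \<Longrightarrow> g x \<noteq> 0"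
  shows "C_k_on m S (\<lambda>x. f x / g x)"
  unfolding divide_inverse by (intro C_k_on_mult C_k_on_inverse assms)

lemma C_k_on_reflect:
  assumes "open S" "open T" "\<And>t. t \<in> T \<Longrightarrow> 1 - t \<in> S" "C_k_on m S g"
  shows "C_k_on m T (\<lambda>t. g (1 - t))"
  using assms(4)
proof (induction m arbitrary: g)
  case 0
  then show ?case
    unfolding C_k_on_0
    by (rule continuous_on_compose2[where f = "\<lambda>t. 1 - t"])
      (use assms(3) in \<open>auto intro!: continuous_intros\<close>)
next
  case (Suc m)
  have "C_k_on m T (\<lambda>t. (-1) * deriv g (1 - t))"
    using Suc by (intro C_k_on_mult assms) (auto simp: C_k_on_Suc assms)
  moreover have "((\<lambda>t. g (1 - t)) has_real_derivative (-1) * deriv g (1 - t)) (at t)"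
    if "t \<in> T" for t
  proof -
    have "((\<lambda>t. 1 - t) has_real_derivative -1) (at t)"
      by (auto intro!: derivative_eq_intros)
    with DERIV_chain2[of g "deriv g (1 - t)" "\<lambda>t. 1 - t" t "-1" UNIV]
      C_k_on_DERIV[OF Suc.prems assms(3)[OF that]]
    show ?thesis by simp
  qed
  ultimately show ?case
    by (intro C_k_on_Suc_if_derivative[OF assms(2)])
qed

lemma C_k_on_D_op:
  assumes "open S" "0 \<notin> S" "C_k_on (Suc m) S F"
  shows "C_k_on m S (D_op F)"
  unfolding D_op_def[abs_def] using assms
  by (intro C_k_on_mult C_k_on_divide) (auto simp: C_k_on_Suc)

lemma C_k_on_D_op_funpow:
  assumes "open S" "0 \<notin> S"
  shows "C_k_on (m + j) S F \<Longrightarrow> C_k_on m S ((D_op ^^ j) F)"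
  by (induction j arbitrary: m) (auto intro!: C_k_on_D_op[OF assms])

lemma D_op_eqI: "(F has_real_derivative d) (at t) \<Longrightarrow> D_op F t = d / t"
  by (simp add: D_op_def DERIV_imp_deriv)

lemma D_op_cong_ev: "\<forall>\<^sub>F y in nhds x. F y = G y \<Longrightarrow> D_op F x = D_op G x"
  unfolding D_op_def by (simp add: deriv_cong_ev)

lemma D_op_funpow_cong:
  assumes "open S"
  shows "(\<And>x. x \<in> S \<Longrightarrow> F x = G x) \<Longrightarrow> x \<in> S \<Longrightarrow> (D_op ^^ j) F x = (D_op ^^ j) G x"
proof (induction j arbitrary: x)
  case (Suc j)
  have "\<forall>\<^sub>F y in nhds x. (D_op ^^ j) F y = (D_op ^^ j) G y"
    using Suc assms by (auto simp: eventually_nhds)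
  then show ?case by (simp add: D_op_cong_ev)
qed auto

lemma D_op_funpow_lincomb:
  assumes "open S" "0 \<notin> S"
  shows "C_k_on j S F \<Longrightarrow> C_k_on j S G \<Longrightarrow> x \<in> S \<Longrightarrow>
    (D_op ^^ j) (\<lambda>x. a * F x + b * G x) x = a * (D_op ^^ j) F x + b * (D_op ^^ j) G x"
proof (induction j arbitrary: x)
  case (Suc j)
  have "\<forall>\<^sub>F y in nhds x. (D_op ^^ j) (\<lambda>x. a * F x + b * G x) y =
      a * (D_op ^^ j) F y + b * (D_op ^^ j) G y"
    using Suc assms C_k_on_SucD by (auto simp: eventually_nhds intro!: exI[of _ S])
  then have "D_op ((D_op ^^ j) (\<lambda>x. a * F x + b * G x)) x =
      D_op (\<lambda>y. a * (D_op ^^ j) F y + b * (D_op ^^ j) G y) x"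
    by (rule D_op_cong_ev)
  also have "C_k_on (Suc 0) S ((D_op ^^ j) F)" "C_k_on (Suc 0) S ((D_op ^^ j) G)"
    using Suc.prems by (auto intro!: C_k_on_D_op_funpow assms)
  then have "D_op (\<lambda>y. a * (D_op ^^ j) F y + b * (D_op ^^ j) G y) x =
      (a * deriv ((D_op ^^ j) F) x + b * deriv ((D_op ^^ j) G) x) / x"
    using Suc.prems(3)
    by (intro D_op_eqI DERIV_add DERIV_cmult) (auto intro: C_k_on_DERIV)
  also have "\<dots> = a * D_op ((D_op ^^ j) F) x + b * D_op ((D_op ^^ j) G) x"
    unfolding D_op_def by (simp add: add_divide_distrib)
  finally show ?case by simp
qed auto

text \<open>Infinitely differentiable functions on an open set of real numbers.\<close>
abbreviation smooth_on :: "real set \<Rightarrow> (real \<Rightarrow> real) \<Rightarrow> bool" where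
  "smooth_on S g \<equiv> \<forall>m. C_k_on m S g"

section \<open>The operators and reverse Bessel polynomials\<close>

text \<open>
  \<open>bessel_coeff k m\<close> is the coefficient of \<open>x ^ m\<close> in the reverse Bessel polynomial of degree \<open>k\<close>,
  and zero for \<open>m > k\<close>. It is the coefficient of \<open>(1 - t) ^ m * D ^ m\<close> in \<open>L_op k\<close>, the summation
  index of \<open>L_op\<close> being \<open>k - m\<close>.
\<close>
definition bessel_coeff :: "nat \<Rightarrow> nat \<Rightarrow> real" where
  "bessel_coeff k m =
     (if m \<le> k then fact (2 * k - m) / (fact m * fact (k - m) * 2 ^ (k - m)) else 0)"

lemma bessel_coeff_eq_0 [simp]: "k < m \<Longrightarrow> bessel_coeff k m = 0"
  by (simp add: bessel_coeff_def)

lemma bessel_coeff_self [simp]: "bessel_coeff k k = 1"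
  by (simp add: bessel_coeff_def mult_2)

lemma bessel_coeff_add:
  "bessel_coeff (m + d) m = fact (m + 2 * d) / (fact m * fact d * 2 ^ d)"
proof -
  have "2 * (m + d) - m = m + 2 * d" by simp
  then show ?thesis by (simp add: bessel_coeff_def)
qed

lemma bessel_coeff_Suc_0: "bessel_coeff (Suc k) 0 = real (2 * k + 1) * bessel_coeff k 0"
proof -
  have 1: "bessel_coeff (Suc k) 0 =
      2 * (real k + 1) * ((2 * real k + 1) * fact (2 * k)) / ((real k + 1) * fact k * (2 * 2 ^ k))"
    using bessel_coeff_add[of 0 "Suc k"] by (simp add: algebra_simps)
  have 2: "bessel_coeff k 0 = fact (2 * k) / (fact k * 2 ^ k)"
    using bessel_coeff_add[of 0 k] by simp
  have "real k + 1 \<noteq> 0" by linarith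
  then show ?thesis
    unfolding 1 2 by (simp add: divide_simps) (simp add: algebra_simps)
qed

text \<open>
  Together with \<open>bessel_coeff_Suc_0\<close> this is the relation
  \<open>\<theta>\<^sub>k\<^sub>+\<^sub>1 = (2 k + 1) \<theta>\<^sub>k - x \<theta>\<^sub>k' + x \<theta>\<^sub>k\<close> for the reverse Bessel polynomials \<open>\<theta>\<^sub>k\<close>.
\<close>
lemma bessel_coeff_Suc_Suc:
  "bessel_coeff (Suc k) (Suc m) = (2 * real k - real m) * bessel_coeff k (Suc m) + bessel_coeff k m"
proof -
  consider "k < m" | "m = k" | d where "k = Suc (m + d)"
    by (metis less_iff_Suc_add linorder_less_linear)
  then show ?thesis
  proof cases
    case (3 d)
    define X A B C :: real
      where "X = fact (m + 2 * d + 1)" and "A = fact m" and "B = fact d" and "C = 2 ^ d"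
    have nz: "X \<noteq> 0" "A \<noteq> 0" "B \<noteq> 0" "C \<noteq> 0"
      by (simp_all add: X_def A_def B_def C_def)
    have 0: "real m + 2 * real d + 3 \<noteq> 0" "real d + 1 \<noteq> 0" "real m + 1 \<noteq> 0"
      by linarith+
    have e: "Suc m + 2 * Suc d = Suc (Suc (m + 2 * d + 1))" "m + 2 * Suc d = Suc (m + 2 * d + 1)"
      "Suc m + 2 * d = m + 2 * d + 1" by simp_all
    have 1: "bessel_coeff (Suc k) (Suc m) =
        (m + 2 * d + 3) * (m + 2 * d + 2) * X / ((m + 1) * A * ((d + 1) * B) * (2 * C))"
      using bessel_coeff_add[of "Suc m" "Suc d"] 3
      unfolding e fact_Suc X_def[symmetric] A_def[symmetric] B_def[symmetric] C_def[symmetric]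
      by (simp add: C_def algebra_simps)
    have 2: "bessel_coeff k (Suc m) = X / ((m + 1) * A * B * C)"
      using bessel_coeff_add[of "Suc m" d] 3 unfolding e fact_Suc
      by (simp add: X_def A_def B_def C_def add_ac)
    have 4: "bessel_coeff k m = (m + 2 * d + 2) * X / (A * ((d + 1) * B) * (2 * C))"
      using bessel_coeff_add[of m "Suc d"] 3
      unfolding e fact_Suc X_def[symmetric] A_def[symmetric] B_def[symmetric]
      by (simp add: C_def add_ac mult_ac)
    have rk: "real k = real m + real d + 1"
      using 3 by simp
    show ?thesis
      unfolding 1 2 4 rk using nz 0 by (simp add: divide_simps) (simp add: algebra_simps)
  qed auto
qed

text \<open>The relation \<open>\<theta>\<^sub>k\<^sub>+\<^sub>1' = \<theta>\<^sub>k\<^sub>+\<^sub>1 - x \<theta>\<^sub>k\<close>.\<close>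
lemma bessel_coeff_deriv:
  "real (Suc m) * bessel_coeff (Suc k) (Suc m) =
     bessel_coeff (Suc k) m - (if m = 0 then 0 else bessel_coeff k (m - 1))"
proof -
  consider "m = Suc k" | "Suc k < m" | d where "k = m + d" 
    by (metis le_Suc_ex linorder_not_less not_less_eq nat_neq_iff)
  then show ?thesis
  proof cases
    case (3 d)
    define X A B C :: real
      where "X = fact (m + 2 * d + 1)" and "A = fact m" and "B = fact d" and "C = 2 ^ d"
    have nz: "X \<noteq> 0" "A \<noteq> 0" "B \<noteq> 0" "C \<noteq> 0"
      by (simp_all add: X_def A_def B_def C_def)
    have 0: "real d + 1 \<noteq> 0" "real m + 1 \<noteq> 0"
      by linarith+
    have e: "m + 2 * Suc d = Suc (m + 2 * d + 1)"
      "Suc m + 2 * d = m + 2 * d + 1" by simp_all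
    have 1: "bessel_coeff (Suc k) (Suc m) = X / ((m + 1) * A * B * C)"
      using bessel_coeff_add[of "Suc m" d] 3 unfolding e fact_Suc
      by (simp add: X_def A_def B_def C_def add_ac)
    have 2: "bessel_coeff (Suc k) m = (m + 2 * d + 2) * X / (A * ((d + 1) * B) * (2 * C))"
      using bessel_coeff_add[of m "Suc d"] 3
      unfolding e fact_Suc X_def[symmetric] A_def[symmetric] B_def[symmetric]
      by (simp add: C_def add_ac mult_ac)
    have 4: "(if m = 0 then 0 else bessel_coeff k (m - 1)) = m * X / (A * ((d + 1) * B) * (2 * C))"
    proof (cases m)
      case (Suc j)
      have "bessel_coeff k j = X / (fact j * ((d + 1) * B) * (2 * C))"
        using bessel_coeff_add[of j "Suc d"] 3 Suc
        by (simp add: X_def B_def C_def add_ac mult_ac)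
      moreover have "A = real m * fact j"
        using Suc by (simp add: A_def)
      ultimately show ?thesis
        using Suc by simp
    qed simp
    show ?thesis
      unfolding 1 2 4 using nz 0 by (simp add: divide_simps) (simp add: algebra_simps)
  qed auto
qed

text \<open>
  The linear functional \<open>x ^ m \<mapsto> e m\<close> evaluated at the reverse Bessel polynomial of degree \<open>k\<close>.
  With \<open>e m = (1 - s) ^ m * (D_op ^^ m) F s\<close> it gives \<open>L_op k F s\<close>, so that identities between the
  polynomials become identities between the operators, although \<open>D\<close> does not commute with
  multiplication by \<open>1 - s\<close>.
\<close>
definition bessel_sum :: "nat \<Rightarrow> (nat \<Rightarrow> real) \<Rightarrow> real" where
  "bessel_sum k e = (\<Sum>m\<le>k. bessel_coeff k m * e m)"

lemma bessel_sum_Suc: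
  "bessel_sum (Suc k) e =
     (\<Sum>m\<le>k. (2 * real k + 1 - real m) * bessel_coeff k m * e m) + bessel_sum k (\<lambda>m. e (Suc m))"
proof -
  have "bessel_sum (Suc k) e =
      bessel_coeff (Suc k) 0 * e 0 + (\<Sum>m\<le>k. bessel_coeff (Suc k) (Suc m) * e (Suc m))"
    unfolding bessel_sum_def by (rule sum.atMost_Suc_shift)
  also have "(\<Sum>m\<le>k. bessel_coeff (Suc k) (Suc m) * e (Suc m)) =
      (\<Sum>m\<le>k. (2 * real k - real m) * bessel_coeff k (Suc m) * e (Suc m)) +
      bessel_sum k (\<lambda>m. e (Suc m))"
    unfolding bessel_sum_def sum.distrib[symmetric] bessel_coeff_Suc_Suc
    by (simp add: algebra_simps)
  also have "bessel_coeff (Suc k) 0 * e 0 +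
      ((\<Sum>m\<le>k. (2 * real k - real m) * bessel_coeff k (Suc m) * e (Suc m)) +
        bessel_sum k (\<lambda>m. e (Suc m))) =
      (\<Sum>m\<le>Suc k. (2 * real k + 1 - real m) * bessel_coeff k m * e m) +
        bessel_sum k (\<lambda>m. e (Suc m))"
    by (subst sum.atMost_Suc_shift) (simp add: bessel_coeff_Suc_0 algebra_simps)
  finally show ?thesis by simp
qed

text \<open>The relation between \<open>\<theta>\<^sub>k\<^sub>+\<^sub>1'\<close>, \<open>\<theta>\<^sub>k\<^sub>+\<^sub>1\<close> and \<open>\<theta>\<^sub>k\<close> in terms of the functional.\<close>
lemma bessel_sum_derivative:
  "(\<Sum>m\<le>Suc k. bessel_coeff (Suc k) m * (real m * e (m - 1))) =
     bessel_sum (Suc k) e - bessel_sum k (\<lambda>m. e (Suc m))"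
proof -
  have "(\<Sum>m\<le>Suc k. bessel_coeff (Suc k) m * (real m * e (m - 1))) =
      (\<Sum>m\<le>k. real (Suc m) * bessel_coeff (Suc k) (Suc m) * e m)"
    by (subst sum.atMost_Suc_shift) (simp add: mult_ac)
  also have "\<dots> = (\<Sum>m\<le>Suc k. real (Suc m) * bessel_coeff (Suc k) (Suc m) * e m)"
    by simp
  also have "\<dots> = bessel_sum (Suc k) e -
      (\<Sum>m\<le>Suc k. (if m = 0 then 0 else bessel_coeff k (m - 1)) * e m)"
    unfolding bessel_coeff_deriv bessel_sum_def by (simp only: left_diff_distrib sum_subtractf)
  also have "(\<Sum>m\<le>Suc k. (if m = 0 then 0 else bessel_coeff k (m - 1)) * e m) =
      bessel_sum k (\<lambda>m. e (Suc m))"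
    by (subst sum.atMost_Suc_shift) (simp add: bessel_sum_def)
  finally show ?thesis .
qed

text \<open>The relation \<open>\<theta>\<^sub>k\<^sub>+\<^sub>2 = (2 k + 3) \<theta>\<^sub>k\<^sub>+\<^sub>1 + x\<^sup>2 \<theta>\<^sub>k\<close>.\<close>
lemma bessel_sum_three_term:
  "bessel_sum (Suc (Suc k)) e =
     (2 * real k + 3) * bessel_sum (Suc k) e + bessel_sum k (\<lambda>m. e (Suc (Suc m)))"
proof -
  have "(\<Sum>m\<le>Suc k. (2 * real (Suc k) + 1 - real m) * bessel_coeff (Suc k) m * e m) =
      (2 * real k + 3) * bessel_sum (Suc k) e -
      (\<Sum>m\<le>Suc k. bessel_coeff (Suc k) m * (real m * e (Suc (m - 1))))"
  proof -
    have "bessel_coeff (Suc k) m * (real m * e (Suc (m - 1))) =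
        bessel_coeff (Suc k) m * (real m * e m)" for m
      by (cases m) auto
    then show ?thesis
      unfolding bessel_sum_def sum_distrib_left sum_subtractf[symmetric]
      by (intro sum.cong) (auto simp: algebra_simps)
  qed
  then show ?thesis
    unfolding bessel_sum_Suc[of "Suc k" e]
    using bessel_sum_derivative[of k "\<lambda>m. e (Suc m)"] by simp
qed

lemma L_op_conv_bessel_sum: "L_op k F s = bessel_sum k (\<lambda>m. (1 - s) ^ m * (D_op ^^ m) F s)"
proof -
  have "L_op k F s = (\<Sum>m=0..k. fact (k + (k + 0 - m)) /
      (fact (k - (k + 0 - m)) * fact (k + 0 - m) * 2 ^ (k + 0 - m)) *
        (1 - s) ^ (k - (k + 0 - m)) * (D_op ^^ (k - (k + 0 - m))) F s)"
    unfolding L_op_def by (subst sum.atLeastAtMost_rev) simp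
  also have "\<dots> = (\<Sum>m=0..k. bessel_coeff k m * ((1 - s) ^ m * (D_op ^^ m) F s))"
    by (intro sum.cong) (auto simp: bessel_coeff_def mult_2)
  finally show ?thesis
    by (simp add: bessel_sum_def atMost_atLeast0)
qed

lemma bessel_sum_shift:
  "bessel_sum k (\<lambda>m. (1 - s) ^ Suc m * (D_op ^^ Suc m) F s) = (1 - s) * L_op k (D_op F) s"
  unfolding L_op_conv_bessel_sum bessel_sum_def sum_distrib_left
  by (simp only: funpow_Suc_right o_apply power_Suc mult_ac)

lemma L_op_three_term:
  "L_op (Suc (Suc k)) F s =
     (2 * real k + 3) * L_op (Suc k) F s + (1 - s)\<^sup>2 * L_op k (D_op (D_op F)) s"
proof -
  have "bessel_sum k (\<lambda>m. (1 - s) ^ Suc (Suc m) * (D_op ^^ Suc (Suc m)) F s) =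
      (1 - s)\<^sup>2 * L_op k (D_op (D_op F)) s"
    unfolding L_op_conv_bessel_sum bessel_sum_def sum_distrib_left
    by (simp only: funpow_Suc_right o_apply power_Suc power2_eq_square mult_ac)
  then show ?thesis
    using bessel_sum_three_term by (simp only: L_op_conv_bessel_sum[of "Suc _"])
qed

text \<open>
  In the variable \<open>s\<^sup>2 / 2\<close> the operator \<open>D\<close> is the derivative, and multiplication by \<open>s\<^sup>2\<close> is
  multiplication by twice that variable; hence there is only one commutator term. For \<open>m = 0\<close> the
  index \<open>m - 1\<close> is harmless because of the factor \<open>m\<close>.
\<close>
lemma D_op_funpow_mult_square:
  assumes S: "open S" "0 \<notin> S" and "smooth_on S G"
  shows "s \<in> S \<Longrightarrow> (D_op ^^ m) (\<lambda>r. r\<^sup>2 * G r) s =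
     s\<^sup>2 * (D_op ^^ m) G s + 2 * (real m * (D_op ^^ (m - 1)) G s)"
proof (induction m arbitrary: s)
  case (Suc m)
  have d: "((D_op ^^ j) G has_real_derivative s * (D_op ^^ Suc j) G s) (at s)" for j
  proof -
    have "C_k_on (Suc 0) S ((D_op ^^ j) G)"
      using assms by (intro C_k_on_D_op_funpow) auto
    from C_k_on_DERIV[OF this Suc.prems] show ?thesis
      using Suc.prems S by (cases "s = 0") (auto simp: D_op_def)
  qed
  have "(D_op ^^ Suc m) (\<lambda>r. r\<^sup>2 * G r) s =
      D_op (\<lambda>r. r\<^sup>2 * (D_op ^^ m) G r + 2 * (real m * (D_op ^^ (m - 1)) G r)) s"
    using Suc S by (auto intro!: D_op_cong_ev simp: eventually_nhds intro!: exI[of _ S])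
  also have "\<dots> = (2 * s * (D_op ^^ m) G s + s\<^sup>2 * (s * (D_op ^^ Suc m) G s) +
      2 * (real m * (s * (D_op ^^ Suc (m - 1)) G s))) / s"
    by (rule D_op_eqI) (auto intro!: derivative_eq_intros d)
  also have "real m * (s * (D_op ^^ Suc (m - 1)) G s) = real m * (s * (D_op ^^ m) G s)"
    by (cases m) auto
  also have "(2 * s * (D_op ^^ m) G s + s\<^sup>2 * (s * (D_op ^^ Suc m) G s) +
      2 * (real m * (s * (D_op ^^ m) G s))) / s =
      s\<^sup>2 * (D_op ^^ Suc m) G s + 2 * (real (Suc m) * (D_op ^^ m) G s)"
  proof -
    have "s \<noteq> 0" using Suc.prems S by auto
    then show ?thesis by (simp add: add_divide_distrib algebra_simps)
  qed
  finally show ?case by simp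
qed simp

text \<open>The commutator terms add up to the functional applied to \<open>\<theta>\<^sub>k\<^sub>+\<^sub>1'\<close>.\<close>
lemma L_op_mult_square:
  assumes S: "open S" "0 \<notin> S" and "smooth_on S G" and "s \<in> S"
  shows "L_op (Suc k) (\<lambda>r. r\<^sup>2 * G r) s =
     (1 + (1 - s)\<^sup>2) * L_op (Suc k) G s - 2 * (1 - s)\<^sup>2 * L_op k (D_op G) s"
proof -
  let ?e = "\<lambda>m. (1 - s) ^ m * (D_op ^^ m) G s"
  have "L_op (Suc k) (\<lambda>r. r\<^sup>2 * G r) s = s\<^sup>2 * bessel_sum (Suc k) ?e +
      2 * (1 - s) * (\<Sum>m\<le>Suc k. bessel_coeff (Suc k) m * (real m * ?e (m - 1)))"
  proof -
    have "bessel_coeff (Suc k) m * ((1 - s) ^ m * (D_op ^^ m) (\<lambda>r. r\<^sup>2 * G r) s) =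
        s\<^sup>2 * (bessel_coeff (Suc k) m * ?e m) +
        2 * (1 - s) * (bessel_coeff (Suc k) m * (real m * ?e (m - 1)))" for m
      unfolding D_op_funpow_mult_square[OF assms] by (cases m) (auto simp: algebra_simps)
    then show ?thesis
      unfolding L_op_conv_bessel_sum bessel_sum_def
      by (simp only: sum_distrib_left sum.distrib)
  qed
  also have "\<dots> = s\<^sup>2 * L_op (Suc k) G s +
      2 * (1 - s) * (L_op (Suc k) G s - (1 - s) * L_op k (D_op G) s)"
    using bessel_sum_derivative[of k ?e] by (simp only: bessel_sum_shift
        L_op_conv_bessel_sum[of "Suc k"])
  also have "\<dots> = (s\<^sup>2 + 2 * (1 - s)) * L_op (Suc k) G s - 2 * (1 - s)\<^sup>2 * L_op k (D_op G) s"
    by (simp add: algebra_simps power2_eq_square)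
  also have "s\<^sup>2 + 2 * (1 - s) = 1 + (1 - s)\<^sup>2"
    by (simp add: power2_eq_square algebra_simps)
  finally show ?thesis .
qed

text \<open>
  The right-hand side of the differential equation, up to a constant and a power of \<open>t\<close>, as a
  function of \<open>t\<close>.
\<close>
definition scaled_L :: "nat \<Rightarrow> (real \<Rightarrow> real) \<Rightarrow> real \<Rightarrow> real" where
  "scaled_L k G t = L_op k G (1 - t) / t ^ (2 * k + 1)"

text \<open>
  With the denominator \<open>t ^ (2 * k + 1)\<close> the derivative of the quotient combines with the relation
  for \<open>\<theta>\<^sub>k\<^sub>+\<^sub>1\<close> in terms of \<open>\<theta>\<^sub>k\<close> and \<open>\<theta>\<^sub>k'\<close>, so that \<open>D\<close> raises the index.
\<close>
lemma D_op_scaled_L: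
  assumes S: "open S" "0 \<notin> S" and "smooth_on S G" and t: "1 - t \<in> S" "t \<noteq> 0"
  shows "D_op (scaled_L k G) t = scaled_L k (D_op G) t - scaled_L (Suc k) G t"
proof -
  let ?e = "\<lambda>m. t ^ m * (D_op ^^ m) G (1 - t)"
  let ?N' = "\<Sum>m\<le>k. bessel_coeff k m * (real m * t ^ (m - 1) * (D_op ^^ m) G (1 - t) +
      t ^ m * (- ((1 - t) * (D_op ^^ Suc m) G (1 - t))))"
  have "((\<lambda>t. (D_op ^^ j) G (1 - t)) has_real_derivative - ((1 - t) * (D_op ^^ Suc j) G (1 - t)))
      (at t)"
    for j
  proof -
    have "C_k_on (Suc 0) S ((D_op ^^ j) G)"
      using assms by (intro C_k_on_D_op_funpow) auto
    from C_k_on_DERIV[OF this t(1)]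
    have "((D_op ^^ j) G has_real_derivative (1 - t) * (D_op ^^ Suc j) G (1 - t)) (at (1 - t))"
      using t S by (cases "1 - t = 0") (auto simp: D_op_def)
    moreover have "((\<lambda>t. 1 - t) has_real_derivative -1) (at t)"
      by (auto intro!: derivative_eq_intros)
    ultimately show ?thesis
      using DERIV_chain2[of "(D_op ^^ j) G" "(1 - t) * (D_op ^^ Suc j) G (1 - t)" "\<lambda>t. 1 - t"
          t "-1" UNIV]
      by simp
  qed
  then have "((\<lambda>t. L_op k G (1 - t)) has_real_derivative ?N') (at t)"
    unfolding L_op_conv_bessel_sum bessel_sum_def
    by (auto intro!: derivative_eq_intros sum.cong simp: algebra_simps)
  then have "(scaled_L k G has_real_derivative
      (?N' * t ^ (2 * k + 1) - L_op k G (1 - t) * (real (2 * k + 1) * t ^ (2 * k))) /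
      (t ^ (2 * k + 1) * t ^ (2 * k + 1))) (at t)"
    unfolding scaled_L_def[abs_def] using t(2) DERIV_pow[of "2 * k + 1" t]
    by (intro DERIV_divide) auto
  then have "D_op (scaled_L k G) t =
      (?N' * t ^ (2 * k + 1) - L_op k G (1 - t) * (real (2 * k + 1) * t ^ (2 * k))) /
      (t ^ (2 * k + 1) * t ^ (2 * k + 1)) / t"
    by (rule D_op_eqI)
  also have "\<dots> = (t * ?N' - (2 * real k + 1) * L_op k G (1 - t)) / t ^ (2 * k + 3)"
  proof -
    have p: "t ^ (2 * k + 1) = t * t ^ (2 * k)" "t ^ (2 * k + 3) = t * t * t * t ^ (2 * k)"
      by (simp_all add: power_add power3_eq_cube eval_nat_numeral)
    have "t ^ (2 * k) \<noteq> 0" using t by simp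
    then show ?thesis
      unfolding p using t(2) by (simp add: divide_simps) (simp add: algebra_simps)
  qed
  also have "t * ?N' = (\<Sum>m\<le>k. real m * bessel_coeff k m * ?e m) -
      (1 - t) * bessel_sum k (\<lambda>m. ?e (Suc m))"
    unfolding bessel_sum_def sum_distrib_left sum_subtractf[symmetric]
    by (intro sum.cong refl) (auto simp: algebra_simps power_eq_if)
  also have "(2 * real k + 1) * L_op k G (1 - t) = (\<Sum>m\<le>k. real m * bessel_coeff k m * ?e m) +
      (bessel_sum (Suc k) ?e - bessel_sum k (\<lambda>m. ?e (Suc m)))"
    unfolding bessel_sum_Suc
    by (simp add: L_op_conv_bessel_sum bessel_sum_def sum_distrib_left sum.distrib[symmetric]
        algebra_simps)
  also have "(\<Sum>m\<le>k. real m * bessel_coeff k m * ?e m) - (1 - t) * bessel_sum k (\<lambda>m. ?e (Suc m)) -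
      ((\<Sum>m\<le>k. real m * bessel_coeff k m * ?e m) +
      (bessel_sum (Suc k) ?e - bessel_sum k (\<lambda>m. ?e (Suc m)))) =
      t * bessel_sum k (\<lambda>m. ?e (Suc m)) - bessel_sum (Suc k) ?e"
    by (simp add: algebra_simps)
  also have "bessel_sum k (\<lambda>m. ?e (Suc m)) = t * L_op k (D_op G) (1 - t)"
    using bessel_sum_shift[of k "1 - t" G] by simp
  also have "bessel_sum (Suc k) ?e = L_op (Suc k) G (1 - t)"
    by (simp add: L_op_conv_bessel_sum)
  also have "(t * (t * L_op k (D_op G) (1 - t)) - L_op (Suc k) G (1 - t)) / t ^ (2 * k + 3) =
      scaled_L k (D_op G) t - scaled_L (Suc k) G t"
    unfolding scaled_L_def using t(2) by (simp add: diff_divide_distrib eval_nat_numeral)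
  finally show ?thesis .
qed

lemma smooth_on_scaled_L:
  assumes "smooth_on {0<..<1} G"
  shows "smooth_on {0<..<1} (scaled_L k G)"
  unfolding scaled_L_def[abs_def] L_op_conv_bessel_sum bessel_sum_def using assms
  by (auto intro!: C_k_on_divide C_k_on_power C_k_on_sum C_k_on_mult C_k_on_diff C_k_on_D_op_funpow
      C_k_on_reflect[where S = "{0<..<1}" and g = "(D_op ^^ _) _"])

text \<open>
  Applying \<open>D_op_scaled_L\<close> twice gives
  \<open>D\<^sup>2 W\<^sub>k[G] = W\<^sub>k[D\<^sup>2 G] - 2 W\<^sub>k\<^sub>+\<^sub>1[D G] + W\<^sub>k\<^sub>+\<^sub>2[G]\<close>; the three-term relation absorbs the first term
  and \<open>L_op_mult_square\<close> the second.
\<close>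
lemma scaled_L_recurrence:
  assumes G: "smooth_on {0<..<1} G" and t: "t \<in> {0<..<1}"
  shows "scaled_L (Suc (Suc k)) (\<lambda>r. r\<^sup>2 * G r) t =
      D_op (D_op (scaled_L k G)) t + (2 * real k + 3) * scaled_L (Suc k) G t"
proof -
  let ?I = "{0<..<1::real}"
  have I: "open ?I" "0 \<notin> ?I" "1 - t \<in> ?I" "t \<noteq> 0"
    using t by auto
  have DG: "smooth_on ?I (D_op G)"
    using G by (auto intro!: C_k_on_D_op)
  have "D_op (D_op (scaled_L k G)) t =
      D_op (\<lambda>u. 1 * scaled_L k (D_op G) u + (-1) * scaled_L (Suc k) G u) t"
    using t by (intro D_op_cong_ev)
      (auto simp: eventually_nhds D_op_scaled_L[OF I(1,2) G] intro!: exI[of _ ?I])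
  also have "\<dots> = 1 * D_op (scaled_L k (D_op G)) t + (-1) * D_op (scaled_L (Suc k) G) t"
    using D_op_funpow_lincomb[OF I(1,2), of 1 "scaled_L k (D_op G)" "scaled_L (Suc k) G" t 1 "-1"]
      smooth_on_scaled_L[OF G] smooth_on_scaled_L[OF DG] t by simp
  also have "\<dots> = scaled_L k (D_op (D_op G)) t - 2 * scaled_L (Suc k) (D_op G) t +
      scaled_L (Suc (Suc k)) G t"
    by (simp add: D_op_scaled_L[OF I(1,2) G I(3,4)] D_op_scaled_L[OF I(1,2) DG I(3,4)])
  finally have DD: "D_op (D_op (scaled_L k G)) t =
      scaled_L k (D_op (D_op G)) t - 2 * scaled_L (Suc k) (D_op G) t + scaled_L (Suc (Suc k)) G t" .
  have p: "t ^ (2 * Suc (Suc k) + 1) = t ^ 4 * t ^ (2 * k + 1)" "t ^ (2 * Suc k + 1) =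
      t\<^sup>2 * t ^ (2 * k + 1)"
    by (simp_all add: power2_eq_square eval_nat_numeral)
  have "t ^ (2 * k + 1) \<noteq> 0" using I(4) by simp
  then show ?thesis
    unfolding DD scaled_L_def L_op_mult_square[OF I(1,2) G I(3)] p
    using I(4) L_op_three_term[of k G "1 - t"]
    by (simp add: divide_simps) (simp add: power2_eq_square eval_nat_numeral algebra_simps)
qed

section \<open>Integrals against powers of the kernel\<close>

text \<open>
  If \<open>r\<close> is the norm of \<open>p + t *\<^sub>R \<theta>\<close> for unit vectors \<open>p\<close> and \<open>\<theta>\<close>, then
  \<open>mean_kernel r t = 4 * t\<^sup>2 * (1 - s\<^sup>2)\<close> with \<open>s = \<theta> \<bullet> p\<close>.
\<close>
definition mean_kernel :: "real \<Rightarrow> real \<Rightarrow> real" where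
  "mean_kernel r t = 4 * t\<^sup>2 - (r\<^sup>2 - 1 - t\<^sup>2)\<^sup>2"

text \<open>The integral \<open>K\<^sub>m[q](t)\<close> to which the spherical mean of a radial function reduces.\<close>
definition kernel_integral :: "nat \<Rightarrow> (real \<Rightarrow> real) \<Rightarrow> real \<Rightarrow> real" where
  "kernel_integral m q t = integral {1 - t..1} (\<lambda>r. q r * mean_kernel r t ^ m)"

lemma continuous_on_mean_kernel: "continuous_on S (\<lambda>r. mean_kernel r t)"
  unfolding mean_kernel_def by (intro continuous_intros)

lemma kernel_integral_integrable:
  assumes "continuous_on {0<..} q" "t \<in> {0<..<1}"
  shows "(\<lambda>r. q r * mean_kernel r t ^ m) integrable_on {1 - t..1}"
  using assms
  by (intro integrable_continuous_interval continuous_intros continuous_on_mean_kernel)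
    (auto intro: continuous_on_subset)

lemma kernel_integral_add:
  assumes "continuous_on {0<..} q" "continuous_on {0<..} q'" "t \<in> {0<..<1}"
  shows "kernel_integral m (\<lambda>r. q r + q' r) t = kernel_integral m q t + kernel_integral m q' t"
  using integral_add[OF kernel_integral_integrable[OF assms(1,3)]
      kernel_integral_integrable[OF assms(2,3)], of m m]
  by (simp add: kernel_integral_def algebra_simps)

lemma kernel_integral_cmult: "kernel_integral m (\<lambda>r. c * q r) t = c * kernel_integral m q t"
  unfolding kernel_integral_def by (simp add: mult.assoc)

text \<open>
  The kernel is a polynomial in \<open>t\<close> with coefficients depending on \<open>r\<close>. Splitting off one factor
  expresses \<open>K\<^sub>m\<^sub>+\<^sub>1\<close> through products of powers of \<open>t\<close> with integrals \<open>K\<^sub>m\<close>, which reduces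
  differentiation under the integral sign to the product rule and the case \<open>m = 0\<close>.
\<close>
lemma kernel_integral_Suc:
  assumes q: "continuous_on {0<..} q" and t: "t \<in> {0<..<1}"
  shows "kernel_integral (Suc m) q t =
    2 * t\<^sup>2 * kernel_integral m (\<lambda>r. (r\<^sup>2 + 1) * q r) t -
        kernel_integral m (\<lambda>r. (r\<^sup>2 - 1)\<^sup>2 * q r) t - t ^ 4 * kernel_integral m q t"
proof -
  let ?k = "\<lambda>r. mean_kernel r t ^ m"
  have i: "((\<lambda>r. p r * q r * ?k r) has_integral kernel_integral m (\<lambda>r. p r * q r) t) {1 - t..1}"
    if "continuous_on {0<..} p" for p
    unfolding kernel_integral_def using that q t
    by (intro integrable_integral kernel_integral_integrable continuous_intros) auto
  have "((\<lambda>r. 2 * t\<^sup>2 * ((r\<^sup>2 + 1) * q r * ?k r) - (r\<^sup>2 - 1)\<^sup>2 * q r * ?k r - t ^ 4 * (1 * q r * ?k r))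
      has_integral (2 * t\<^sup>2 * kernel_integral m (\<lambda>r. (r\<^sup>2 + 1) * q r) t -
          kernel_integral m (\<lambda>r. (r\<^sup>2 - 1)\<^sup>2 * q r) t -
        t ^ 4 * kernel_integral m (\<lambda>r. 1 * q r) t)) {1 - t..1}"
    by (intro has_integral_diff has_integral_mult_right i continuous_intros)
  moreover have "2 * t\<^sup>2 * ((r\<^sup>2 + 1) * q r * ?k r) - (r\<^sup>2 - 1)\<^sup>2 * q r * ?k r -
      t ^ 4 * (1 * q r * ?k r) =
      q r * mean_kernel r t ^ Suc m" for r
    by (simp add: mean_kernel_def power2_eq_square eval_nat_numeral algebra_simps)
  ultimately show ?thesis
    by (simp add: kernel_integral_def[of "Suc m"] integral_unique)
qed

lemma kernel_integral_0_derivative: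
  assumes q: "continuous_on {0<..} q" and t: "t \<in> {0<..<1}"
  shows "(kernel_integral 0 q has_real_derivative q (1 - t)) (at t)"
proof -
  \<comment> \<open>The function \<open>q\<close> is controlled on the positive axis only,
      so the primitive starts at a positive point below \<open>1 - t\<close>.\<close>
  define a where "a = (1 - t) / 2"
  have a: "0 < a" "a < 1 - t"
    using t by (auto simp: a_def)
  have qa: "continuous_on {a..1} q"
    using q a by (auto intro: continuous_on_subset)
  let ?G = "\<lambda>x. integral {a..x} q"
  have "(?G has_real_derivative q (1 - t)) (at (1 - t) within {a..1})"
    using a t by (intro integral_has_real_derivative qa) auto
  then have G: "(?G has_real_derivative q (1 - t)) (at (1 - t))"
    using a t at_within_Icc_at[of a "1 - t" 1] by simp
  have "((\<lambda>t. 1 - t) has_real_derivative -1) (at t)"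
    by (auto intro!: derivative_eq_intros)
  with DERIV_chain2[of ?G "q (1 - t)" "\<lambda>t. 1 - t" t "-1" UNIV] G
  have "((\<lambda>t. ?G (1 - t)) has_real_derivative - q (1 - t)) (at t)" by simp
  then have der: "((\<lambda>t. ?G 1 - ?G (1 - t)) has_real_derivative q (1 - t)) (at t)"
    by (auto intro!: derivative_eq_intros)
  have ev: "\<forall>\<^sub>F u in nhds t. ?G 1 - ?G (1 - u) = kernel_integral 0 q u"
  proof -
    have "?G 1 - ?G (1 - u) = kernel_integral 0 q u" if "u \<in> {0<..<1 - a}" for u
    proof -
      have "?G (1 - u) + integral {1 - u..1} q = ?G 1"
        using that a by (intro Henstock_Kurzweil_Integration.integral_combine
            integrable_continuous_interval qa) auto
      then show ?thesis by (simp add: kernel_integral_def)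
    qed
    then show ?thesis
      using a t unfolding eventually_nhds by (intro exI[of _ "{0<..<1 - a}"]) auto
  qed
  show ?thesis
    by (rule iffD1[OF DERIV_cong_ev[OF refl ev refl] der])
qed

text \<open>
  There is no boundary term because the kernel vanishes at \<open>r = 1 - t\<close>; the integrand is the
  \<open>t\<close>-derivative \<open>4 * t * (r\<^sup>2 + 1 - t\<^sup>2)\<close> of the kernel times \<open>Suc m\<close> times its \<open>m\<close>-th power.
\<close>
lemma kernel_integral_Suc_derivative:
  assumes "continuous_on {0<..} q" and t: "t \<in> {0<..<1}"
  shows "(kernel_integral (Suc m) q has_real_derivative
    4 * real (Suc m) * t * (kernel_integral m (\<lambda>r. (r\<^sup>2 + 1) * q r) t -
        t\<^sup>2 * kernel_integral m q t)) (at t)"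
  using assms(1)
proof (induction m arbitrary: q)
  case (0 q)
  define qa qb where "qa = (\<lambda>r. (r\<^sup>2 + 1) * q r)" and "qb = (\<lambda>r. (r\<^sup>2 - 1)\<^sup>2 * q r)"
  have c: "continuous_on {0<..} qa" "continuous_on {0<..} qb"
    unfolding qa_def qb_def by (intro continuous_intros 0)+
  note kernel_integral_Suc = kernel_integral_Suc[OF 0, folded qa_def qb_def]
  have "2 * t\<^sup>2 * qa (1 - t) - qb (1 - t) - t ^ 4 * q (1 - t) = 0"
    by (simp add: qa_def qb_def power2_eq_square eval_nat_numeral algebra_simps)
  then have "((\<lambda>t. 2 * t\<^sup>2 * kernel_integral 0 qa t - kernel_integral 0 qb t -
      t ^ 4 * kernel_integral 0 q t) has_real_derivative
      4 * real (Suc 0) * t * (kernel_integral 0 qa t - t\<^sup>2 * kernel_integral 0 q t)) (at t)"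
    by - ((rule derivative_eq_intros kernel_integral_0_derivative[OF _ t] c 0 refl)+,
      simp add: power2_eq_square eval_nat_numeral algebra_simps)
  then show ?case
    unfolding qa_def[symmetric]
    by (rule has_field_derivative_transform_within_open[of _ _ _ "{0<..<1}"])
      (use t in \<open>auto simp: kernel_integral_Suc\<close>)
next
  case (Suc m q)
  define qa qb where "qa = (\<lambda>r. (r\<^sup>2 + 1) * q r)" and "qb = (\<lambda>r. (r\<^sup>2 - 1)\<^sup>2 * q r)"
  have c: "continuous_on {0<..} qa" "continuous_on {0<..} qb"
    unfolding qa_def qb_def by (intro continuous_intros Suc.prems)+
  define qaa qab where "qaa = (\<lambda>r. (r\<^sup>2 + 1) * qa r)" and "qab = (\<lambda>r. (r\<^sup>2 - 1)\<^sup>2 * qa r)"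
  have ab: "(\<lambda>r. (r\<^sup>2 + 1) * qb r) = qab"
    by (simp add: qa_def qb_def qab_def mult.left_commute)
  note kernel_integral_Suc = kernel_integral_Suc[OF Suc.prems, folded qa_def qb_def]
      and kernel_integral_Suc_a = kernel_integral_Suc[OF c(1) t, folded qaa_def qab_def]
  note d = Suc.IH[OF c(1), folded qaa_def] Suc.IH[OF c(2), unfolded ab] Suc.IH[OF Suc.prems,
      folded qa_def]
  have "((\<lambda>t. 2 * t\<^sup>2 * kernel_integral (Suc m) qa t - kernel_integral (Suc m) qb t -
      t ^ 4 * kernel_integral (Suc m) q t) has_real_derivative
      4 * real (Suc (Suc m)) * t * (kernel_integral (Suc m) qa t -
          t\<^sup>2 * kernel_integral (Suc m) q t)) (at t)"
    by (rule derivative_eq_intros d refl)+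
      (simp add: kernel_integral_Suc[OF t]
          kernel_integral_Suc_a power2_eq_square eval_nat_numeral algebra_simps)
  then show ?case
    unfolding qa_def[symmetric]
    by (rule has_field_derivative_transform_within_open[of _ _ _ "{0<..<1}"])
      (use t in \<open>auto simp: kernel_integral_Suc\<close>)
qed

lemma smooth_on_kernel_integral:
  assumes "smooth_on {0<..} q"
  shows "smooth_on {0<..<1} (kernel_integral m q)"
proof -
  have "C_k_on j {0<..<1} (kernel_integral m q)" for j
    using assms
  proof (induction j arbitrary: m q)
    case 0
    have c: "continuous_on {0<..} q"
      using 0 by (simp add: C_k_on_continuous)
    have "isCont (kernel_integral m q) t" if "t \<in> {0<..<1}" for t
      using kernel_integral_0_derivative[OF c that] kernel_integral_Suc_derivative[OF c that]
      by (cases m) (auto dest: DERIV_isCont)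
    then show ?case
      by (simp add: C_k_on_0 continuous_at_imp_continuous_on)
  next
    case (Suc j)
    have c: "continuous_on {0<..} q"
      using Suc.prems by (simp add: C_k_on_continuous)
    show ?case
    proof (cases m)
      case 0
      have "C_k_on j {0<..<1} (\<lambda>t. q (1 - t))"
        using Suc.prems by (intro C_k_on_reflect[where S = "{0<..}"]) auto
      with kernel_integral_0_derivative[OF c] show ?thesis
        unfolding 0 by (intro C_k_on_Suc_if_derivative[where g' = "\<lambda>t. q (1 - t)"]) auto
    next
      case (Suc i)
      have "smooth_on {0<..} (\<lambda>r. (r\<^sup>2 + 1) * q r)"
        using Suc.prems by (intro allI C_k_on_mult C_k_on_add C_k_on_power) auto
      then have "C_k_on j {0<..<1}
          (\<lambda>t. 4 * real (Suc i) * t * (kernel_integral i (\<lambda>r. (r\<^sup>2 + 1) * q r) t -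
              t\<^sup>2 * kernel_integral i q t))"
        using Suc.prems by (intro C_k_on_mult C_k_on_diff C_k_on_power Suc.IH) auto
      with kernel_integral_Suc_derivative[OF c] show ?thesis
        unfolding Suc by (intro C_k_on_Suc_if_derivative) auto
    qed
  qed
  then show ?thesis by blast
qed

lemma D_op_kernel_integral_Suc:
  assumes "continuous_on {0<..} q" and t: "t \<in> {0<..<1}"
  shows "D_op (kernel_integral (Suc m) q) t =
      4 * real (Suc m) * (kernel_integral m (\<lambda>r. (r\<^sup>2 + 1) * q r) t - t\<^sup>2 * kernel_integral m q t)"
  using D_op_eqI[OF kernel_integral_Suc_derivative[OF assms]] t by simp

text \<open>The identity \<open>(r\<^sup>2 + 1 - t\<^sup>2)\<^sup>2 = 4 r\<^sup>2 - P(r, t)\<close>, integrated against \<open>q r * P(r, t) ^ m\<close>.\<close>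
lemma kernel_integral_square:
  assumes q: "continuous_on {0<..} q" and t: "t \<in> {0<..<1}"
  shows "kernel_integral m (\<lambda>r. (r\<^sup>2 + 1) * ((r\<^sup>2 + 1) * q r)) t -
      2 * t\<^sup>2 * kernel_integral m (\<lambda>r. (r\<^sup>2 + 1) * q r) t + t ^ 4 * kernel_integral m q t =
    4 * kernel_integral m (\<lambda>r. r\<^sup>2 * q r) t - kernel_integral (Suc m) q t"
proof -
  have "kernel_integral m (\<lambda>r. (r\<^sup>2 + 1) * ((r\<^sup>2 + 1) * q r)) t =
      kernel_integral m (\<lambda>r. 4 * (r\<^sup>2 * q r) + (r\<^sup>2 - 1)\<^sup>2 * q r) t"
    by (intro arg_cong[where f = "\<lambda>q. kernel_integral m q t"])
        (auto simp: power2_eq_square algebra_simps)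
  also have "\<dots> = kernel_integral m (\<lambda>r. 4 * (r\<^sup>2 * q r)) t +
      kernel_integral m (\<lambda>r. (r\<^sup>2 - 1)\<^sup>2 * q r) t"
    by (intro kernel_integral_add continuous_intros q t)
  finally show ?thesis
    by (simp add: kernel_integral_Suc[OF assms] kernel_integral_cmult)
qed

lemma D_op_D_op_kernel_integral:
  assumes q: "continuous_on {0<..} q" and t: "t \<in> {0<..<1}"
  shows "D_op (D_op (kernel_integral (Suc (Suc m)) q)) t =
    64 * (real m + 2) * (real m + 1) * kernel_integral m (\<lambda>r. r\<^sup>2 * q r) t -
    8 * (real m + 2) * (2 * real m + 3) * kernel_integral (Suc m) q t"
proof -
  define qa where "qa = (\<lambda>r. (r\<^sup>2 + 1) * q r)"
  define qaa where "qaa = (\<lambda>r. (r\<^sup>2 + 1) * qa r)"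
  have a: "continuous_on {0<..} qa"
    unfolding qa_def by (intro continuous_intros q)
  note d = kernel_integral_Suc_derivative[OF q t, folded qa_def]
      kernel_integral_Suc_derivative[OF a t, folded qaa_def]
  have "D_op (D_op (kernel_integral (Suc (Suc m)) q)) t =
      D_op (\<lambda>t. 4 * real (Suc (Suc m)) * (kernel_integral (Suc m) qa t -
          t\<^sup>2 * kernel_integral (Suc m) q t)) t"
    using t by (intro D_op_cong_ev)
      (auto simp: eventually_nhds D_op_kernel_integral_Suc[OF q, folded qa_def]
          intro!: exI[of _ "{0<..<1}"])
  also have "\<dots> = 4 * real (Suc (Suc m)) *
      (4 * real (Suc m) * t * (kernel_integral m qaa t - t\<^sup>2 * kernel_integral m qa t) -
          (2 * t * kernel_integral (Suc m) q t +
        t\<^sup>2 * (4 * real (Suc m) * t * (kernel_integral m qa t - t\<^sup>2 * kernel_integral m q t)))) / t"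
    by (rule D_op_eqI, (rule derivative_eq_intros d refl)+)
        (simp add: power2_eq_square algebra_simps)
  also have "\<dots> = 4 * real (Suc (Suc m)) * (4 * real (Suc m) *
      (kernel_integral m qaa t - 2 * t\<^sup>2 * kernel_integral m qa t + t ^ 4 * kernel_integral m q t)
          - 2 * kernel_integral (Suc m) q t)"
    using t by (simp add: divide_simps) (simp add: power2_eq_square eval_nat_numeral algebra_simps)
  also have "kernel_integral m qaa t - 2 * t\<^sup>2 * kernel_integral m qa t +
      t ^ 4 * kernel_integral m q t =
          4 * kernel_integral m (\<lambda>r. r\<^sup>2 * q r) t - kernel_integral (Suc m) q t"
    unfolding qaa_def qa_def by (rule kernel_integral_square[OF assms])
  finally show ?thesis
    by (simp add: algebra_simps)
qed

section \<open>The differential equation for the kernel integrals\<close>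

lemma D_op_kernel_integral_0:
  assumes q: "continuous_on {0<..} q" and t: "t \<in> {0<..<1}"
  shows "D_op (kernel_integral 0 q) t = q (1 - t) / t"
  by (rule D_op_eqI[OF kernel_integral_0_derivative[OF assms]])

text \<open>
  The case \<open>k = 1\<close> of the differential equation. It has to be computed separately, since the
  recursion for \<open>D\<^sup>2 K\<^sub>k\<close> starts at \<open>k = 2\<close>: for \<open>k = 1\<close> the second derivative has a boundary
  term.
\<close>
lemma D_op_cube_kernel_integral_1:
  assumes q: "smooth_on {0<..} q" and t: "t \<in> {0<..<1}"
  shows "D_op (D_op (D_op (kernel_integral (Suc 0) q))) t = - 8 * scaled_L (Suc 0) (\<lambda>r. r\<^sup>2 * q r) t"
proof -
  let ?I = "{0<..<1::real}"
  have c: "continuous_on {0<..} q"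
    using q C_k_on_continuous by blast
  define qa where "qa = (\<lambda>r. (r\<^sup>2 + 1) * q r)"
  have ca: "continuous_on {0<..} qa"
    unfolding qa_def by (intro continuous_intros c)
  have DD: "D_op (D_op (kernel_integral (Suc 0) q)) u =
      8 * ((1 - u) * q (1 - u) / u - kernel_integral 0 q u)" if u: "u \<in> ?I" for u
  proof -
    have "D_op (D_op (kernel_integral (Suc 0) q)) u =
        D_op (\<lambda>t. 4 * (kernel_integral 0 qa t - t\<^sup>2 * kernel_integral 0 q t)) u"
      using u by (intro D_op_cong_ev)
        (auto simp: eventually_nhds D_op_kernel_integral_Suc[OF c, folded qa_def]
          intro!: exI[of _ ?I])
    also have "\<dots> = 4 * (qa (1 - u) - (2 * u * kernel_integral 0 q u + u\<^sup>2 * q (1 - u))) / u"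
      by (rule D_op_eqI, (rule derivative_eq_intros kernel_integral_0_derivative[OF _ u]
          ca c refl)+) simp
    also have "\<dots> = 8 * ((1 - u) * q (1 - u) / u - kernel_integral 0 q u)"
      using u unfolding qa_def by (simp add: divide_simps)
          (simp add: power2_eq_square algebra_simps)
    finally show ?thesis .
  qed
  define d where "d = deriv q (1 - t)"
  have dq: "(q has_real_derivative d) (at (1 - t))"
    unfolding d_def using q t by (intro C_k_on_DERIV[of 0 "{0<..}"]) auto
  have "((\<lambda>t. 1 - t) has_real_derivative -1) (at t)"
    by (auto intro!: derivative_eq_intros)
  with DERIV_chain2[of q d "\<lambda>t. 1 - t" t "-1" UNIV] dq
  have dq': "((\<lambda>t. q (1 - t)) has_real_derivative - d) (at t)" by simp
  have "D_op (D_op (D_op (kernel_integral (Suc 0) q))) t =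
      D_op (\<lambda>u. 8 * ((1 - u) * q (1 - u) / u - kernel_integral 0 q u)) t"
    using t by (intro D_op_cong_ev) (auto simp: eventually_nhds DD intro!: exI[of _ ?I])
  also have "\<dots> = 8 * (((- q (1 - t) - (1 - t) * d) * t - (1 - t) * q (1 - t)) / (t * t) -
      q (1 - t)) / t"
    using t by (intro D_op_eqI) (auto intro!: derivative_eq_intros kernel_integral_0_derivative
        dq' c)
  also have "\<dots> = - 8 * ((t * (2 * q (1 - t) + (1 - t) * d) + (1 - t)\<^sup>2 * q (1 - t)) / t ^ 3)"
    using t by (simp add: divide_simps) (simp add: power2_eq_square power3_eq_cube algebra_simps)
  also have "2 * q (1 - t) + (1 - t) * d = D_op (\<lambda>r. r\<^sup>2 * q r) (1 - t)"
  proof -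
    have "((\<lambda>r. r\<^sup>2 * q r) has_real_derivative 2 * (1 - t) * q (1 - t) + (1 - t)\<^sup>2 * d) (at (1 - t))"
      by (rule derivative_eq_intros dq refl)+ (simp add: algebra_simps)
    from D_op_eqI[OF this] have "D_op (\<lambda>r. r\<^sup>2 * q r) (1 - t) =
        (2 * (1 - t) * q (1 - t) + (1 - t)\<^sup>2 * d) / (1 - t)" .
    also have "\<dots> = 2 * q (1 - t) + (1 - t) * d"
    proof -
      have "(2 * s * a + s\<^sup>2 * b) / s = 2 * a + s * b" if "s \<noteq> 0" for s a b :: real
        using that by (simp add: add_divide_distrib power2_eq_square)
      moreover have "1 - t \<noteq> 0" using t by simp
      ultimately show ?thesis by blast
    qed
    finally show ?thesis ..
  qed
  also have "(t * D_op (\<lambda>r. r\<^sup>2 * q r) (1 - t) + (1 - t)\<^sup>2 * q (1 - t)) / t ^ 3 =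
      scaled_L (Suc 0) (\<lambda>r. r\<^sup>2 * q r) t"
  proof -
    have "bessel_coeff (Suc 0) 0 = 1"
      by (simp add: bessel_coeff_def)
    then show ?thesis
      by (simp add: scaled_L_def L_op_conv_bessel_sum bessel_sum_def eval_nat_numeral)
  qed
  finally show ?thesis .
qed

text \<open>The differential equation for the kernel integrals, divided by \<open>t\<close>.\<close>
proposition D_op_funpow_kernel_integral:
  assumes "smooth_on {0<..} q" and t: "t \<in> {0<..<1}"
  shows "(D_op ^^ (2 * k + 1)) (kernel_integral k q) t =
      (-1) ^ k * fact k * 8 ^ k * scaled_L k (\<lambda>r. r ^ (2 * k) * q r) t"
  using assms
proof (induction k arbitrary: q t rule: less_induct)
  case (less k q t)
  note q = less.prems(1) and t = less.prems(2)
  have c: "continuous_on {0<..} q"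
    using q C_k_on_continuous by blast
  consider "k = 0" | "k = Suc 0" | m where "k = Suc (Suc m)"
    by (metis not0_implies_Suc)
  then show ?case
  proof cases
    case 1
    then show ?thesis
      by (simp add: D_op_kernel_integral_0[OF c t] scaled_L_def L_op_def)
  next
    case 2
    then show ?thesis
      using D_op_cube_kernel_integral_1[OF q t] by (simp add: eval_nat_numeral)
  next
    case (3 m)
    let ?I = "{0<..<1::real}"
    \<comment> \<open>The induction hypotheses for \<open>r\<^sup>2 q\<close> and for \<open>q\<close> involve the same function \<open>G\<close>.\<close>
    define G where "G = (\<lambda>r. r ^ (2 * m + 2) * q r)"
    define c :: "nat \<Rightarrow> real" where "c = (\<lambda>k. (-1) ^ k * fact k * 8 ^ k)"
    have G: "smooth_on ?I G"
      unfolding G_def using q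
      by (intro allI C_k_on_mult C_k_on_power) (auto intro: C_k_on_subset)
    have q2: "smooth_on {0<..} (\<lambda>r. r\<^sup>2 * q r)"
      using q by (intro allI C_k_on_mult C_k_on_power) auto
    have IH1: "(D_op ^^ (2 * m + 1)) (kernel_integral m (\<lambda>r. r\<^sup>2 * q r)) u =
        c m * scaled_L m G u" if "u \<in> ?I" for u
    proof -
      have "(\<lambda>r. r ^ (2 * m) * (r\<^sup>2 * q r)) = G"
        by (simp add: G_def power2_eq_square mult_ac)
      then show ?thesis
        using less.IH[OF _ q2 that, of m] 3 by (simp add: c_def)
    qed
    have IH2: "(D_op ^^ (2 * m + 3)) (kernel_integral (Suc m) q) t =
        c (Suc m) * scaled_L (Suc m) G t"
    proof -
      have "(\<lambda>r. r ^ (2 * Suc m) * q r) = G"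
        by (simp add: G_def)
      moreover have "2 * Suc m + 1 = 2 * m + 3" by simp
      moreover have "(D_op ^^ (2 * Suc m + 1)) (kernel_integral (Suc m) q) t =
          c (Suc m) * scaled_L (Suc m) (\<lambda>r. r ^ (2 * Suc m) * q r) t"
        unfolding c_def using less.IH[OF _ q t] 3 by blast
      ultimately show ?thesis
        by (simp only:)
    qed
    have IH1': "(D_op ^^ (2 * m + 3)) (kernel_integral m (\<lambda>r. r\<^sup>2 * q r)) t =
        c m * D_op (D_op (scaled_L m G)) t"
    proof -
      have "2 * m + 3 = 2 + (2 * m + 1)" by simp
      then have "(D_op ^^ (2 * m + 3)) (kernel_integral m (\<lambda>r. r\<^sup>2 * q r)) t =
          (D_op ^^ 2) ((D_op ^^ (2 * m + 1)) (kernel_integral m (\<lambda>r. r\<^sup>2 * q r))) t"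
        by (simp only: funpow_add o_apply)
      also have "\<dots> = (D_op ^^ 2) (\<lambda>u. c m * scaled_L m G u + 0 * scaled_L m G u) t"
        by (rule D_op_funpow_cong[of ?I]) (use t IH1 in auto)
      also have "\<dots> = c m * (D_op ^^ 2) (scaled_L m G) t + 0 * (D_op ^^ 2) (scaled_L m G) t"
        using t smooth_on_scaled_L[OF G] by (intro D_op_funpow_lincomb[of ?I]) auto
      finally show ?thesis by (simp add: eval_nat_numeral)
    qed
    define a b where "a = 64 * (real m + 2) * (real m + 1)" and "b =
        8 * (real m + 2) * (2 * real m + 3)"
    have "2 * k + 1 = (2 * m + 3) + 2"
      using 3 by simp
    then have "(D_op ^^ (2 * k + 1)) (kernel_integral k q) t =
        (D_op ^^ (2 * m + 3)) ((D_op ^^ 2) (kernel_integral k q)) t"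
      by (simp only: funpow_add o_apply)
    also have "\<dots> = (D_op ^^ (2 * m + 3)) (\<lambda>u. a * kernel_integral m (\<lambda>r. r\<^sup>2 * q r) u +
        (- b) * kernel_integral (Suc m) q u) t"
      using t 3 D_op_D_op_kernel_integral[OF c] by (intro D_op_funpow_cong[of ?I])
          (auto simp: a_def b_def eval_nat_numeral)
    also have "\<dots> = a * (D_op ^^ (2 * m + 3)) (kernel_integral m (\<lambda>r. r\<^sup>2 * q r)) t +
        (- b) * (D_op ^^ (2 * m + 3)) (kernel_integral (Suc m) q) t"
      using t smooth_on_kernel_integral[OF q] smooth_on_kernel_integral[OF q2]
          by (intro D_op_funpow_lincomb[of ?I]) auto
    also have "\<dots> = a * c m * D_op (D_op (scaled_L m G)) t - b * c (Suc m) * scaled_L (Suc m) G t"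
      unfolding IH1' IH2 by simp
    also have "a * c m = c k"
      unfolding 3 by (simp add: a_def c_def algebra_simps)
    also have "b * c (Suc m) = - c k * (2 * real m + 3)"
      unfolding 3 by (simp add: b_def c_def algebra_simps)
    also have "c k * D_op (D_op (scaled_L m G)) t - -
        c k * (2 * real m + 3) * scaled_L (Suc m) G t =
        c k * scaled_L k (\<lambda>r. r\<^sup>2 * G r) t"
      unfolding 3 scaled_L_recurrence[OF G t] by (simp add: algebra_simps)
    also have "(\<lambda>r. r\<^sup>2 * G r) = (\<lambda>r. r ^ (2 * k) * q r)"
      unfolding 3 by (simp add: G_def power2_eq_square mult.assoc)
    finally show ?thesis by (simp add: c_def)
  qed
qed

section \<open>Invariance of Lebesgue measure under orthogonal maps\<close>

text \<open>
  By Vitali's covering theorem every open set is, up to a null set, a countable disjoint union of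
  balls. Preimages of balls under an orthogonal map are balls of the same radius, and preimages of
  null sets are null sets, so the image measure agrees with Lebesgue measure on open sets.
\<close>
lemma lborel_distr_orthogonal:
  fixes T :: "'a::euclidean_space \<Rightarrow> 'a"
  assumes T: "orthogonal_transformation T"
  shows "distr lborel borel T = lborel"
proof -
  define T' where "T' = inv T"
  have T': "orthogonal_transformation T'"
    unfolding T'_def by (rule orthogonal_transformation_inv[OF T])
  have bij: "bij T"
    using T by (rule orthogonal_transformation_bij)
  have TT': "T (T' x) = x" "T' (T x) = x" for x
    using bij by (simp_all add: T'_def bij_is_surj surj_f_inv_f bij_is_inj)
  have vim: "T -` A = T' ` A" for A
    using TT' by (auto simp: image_iff) metis
  have lin: "linear T" "linear T'"
    using T T' by (auto intro: orthogonal_transformation_linear)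
  have [measurable]: "T \<in> borel_measurable borel"
    using lin by (intro borel_measurable_continuous_onI linear_continuous_on
        linear_conv_bounded_linear[THEN iffD1])
  have vim_ball: "T -` ball a r = ball (T' a) r" for a r
  proof -
    have "dist a (T x) = norm (T (T' a - x))" for x
      by (simp add: dist_norm linear_diff[OF lin(1)] TT')
    then have "dist a (T x) = dist (T' a) x" for x
      by (simp add: orthogonal_transformation_norm[OF T] dist_norm)
    then show ?thesis by auto
  qed
  then have vim_borel [simp]: "T -` ball a r \<in> sets borel" for a r
    by simp
  have vim_null: "emeasure lborel (T -` N) = 0" if "negligible N" "N \<in> sets borel" for N
  proof -
    have "negligible (T' ` N)"
      using that(1) lin(2)
      by (intro negligible_differentiable_image_negligible linear_imp_differentiable_on) auto
    moreover have "T -` N \<in> sets borel"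
      using measurable_sets[of T borel borel N] that(2) by simp
    ultimately show ?thesis
      unfolding vim by (metis negligible_iff_null_sets null_setsD1 null_sets_completion_iff
          sets_lborel vim)
  qed
  have open_eq: "emeasure lborel (T -` U) = emeasure lborel U" if U: "open U" for U
  proof -
    obtain C where C: "countable C" "C \<subseteq> {(a, r). 0 < r \<and> ball a r \<subseteq> U}"
      "pairwise (\<lambda>i j. disjnt (ball (fst i) (snd i)) (ball (fst j) (snd j))) C"
      "negligible (U - (\<Union>i\<in>C. ball (fst i) (snd i)))"
    proof (rule Vitali_covering_theorem_balls[of U "{(a, r). 0 < r \<and> ball a r \<subseteq> U}" fst snd])
      fix x and d :: real assume x: "x \<in> U" and d: "0 < d"
      obtain e where "e > 0" "ball x e \<subseteq> U"
        using U x by (rule openE)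
      then show "\<exists>i. i \<in> {(a, r). 0 < r \<and> ball a r \<subseteq> U} \<and> x \<in> ball (fst i) (snd i) \<and> snd i < d"
        using d by (intro exI[of _ "(x, min e (d / 2))"]) auto
    qed
    let ?B = "\<lambda>i. ball (fst i) (snd i)"
    let ?N = "U - (\<Union>i\<in>C. ?B i)"
    have N: "?N \<in> sets borel"
      using U by (intro sets.Diff borel_open open_UN) auto
    have disj: "disjoint_family_on ?B C"
      using C(3) by (auto simp: disjoint_family_on_def pairwise_def disjnt_def)
    have B_sub: "?B i \<subseteq> U" "0 < snd i" if "i \<in> C" for i
      using subsetD[OF C(2) that] by (auto simp: case_prod_beta)
    then have "(\<Union>i\<in>C. ?B i) \<subseteq> U"
      by blast
    then have U_eq: "U = (\<Union>i\<in>C. ?B i) \<union> ?N"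
      by auto
    have UB: "(\<Union>i\<in>C. ?B i) \<in> sets borel"
      by (intro borel_open open_UN) auto
    have N0: "emeasure lborel ?N = 0"
      using C(4) N by (simp add: negligible_iff_null_sets null_setsD1 null_sets_completion_iff)
    have "emeasure lborel U = emeasure lborel (\<Union>i\<in>C. ?B i)"
      using emeasure_Un_null_set[of "\<Union>i\<in>C. ?B i"
          lborel ?N] N N0 UB U_eq by (auto simp: null_sets_def)
    also have "\<dots> = (\<integral>\<^sup>+i. emeasure lborel (?B i) \<partial>count_space C)"
      using C(1) disj by (intro emeasure_UN_countable) auto
    also have "\<dots> = (\<integral>\<^sup>+i. emeasure lborel (T -` ?B i) \<partial>count_space C)"
      unfolding vim_ball by (intro nn_integral_cong) (auto simp: emeasure_ball less_imp_le B_sub(2))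
    also have "\<dots> = emeasure lborel (\<Union>i\<in>C. T -` ?B i)"
      using C(1) disj by (intro emeasure_UN_countable[symmetric])
        (auto simp: disjoint_family_on_def vim_ball[symmetric] vimage_Int[symmetric] simp del:
            vimage_Int)
    also have "\<dots> = emeasure lborel ((\<Union>i\<in>C. T -` ?B i) \<union> T -` ?N)"
      using vim_null[OF C(4) N] measurable_sets[of T borel borel ?N] N C(1)
      by (intro emeasure_Un_null_set[symmetric] sets.countable_UN')
          (auto simp: null_sets_def vim_ball)
    also have "(\<Union>i\<in>C. T -` ?B i) \<union> T -` ?N = T -` U"
      using U_eq by blast
    finally show ?thesis ..
  qed
  show ?thesis
  proof (rule measure_eqI_generator_eq[where E = "{U. open U}" and \<Omega> = UNIV and A =
      "\<lambda>n. ball 0 (real n)"])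
    show "Int_stable {U :: 'a set. open U}"
      by (auto simp: Int_stable_def)
    show "emeasure (distr lborel borel T) U = emeasure lborel U" if "U \<in> {U. open U}" for U
      using that open_eq by (subst emeasure_distr) auto
    show "(\<Union>n. ball 0 (real n)) = (UNIV :: 'a set)"
      using reals_Archimedean2 by auto
    show "emeasure (distr lborel borel T) (ball 0 (real n)) \<noteq> \<infinity>" for n
      by (subst emeasure_distr) (auto simp: open_eq emeasure_ball)
  qed (auto simp: borel_def)
qed

section \<open>The distribution of a coordinate on the sphere\<close>

text \<open>
  The distribution of the Euclidean norm under Lebesgue measure on a finite product of lines,
      obtained
  by differentiating the volume of a ball with respect to its radius.
\<close>
lemma radial_distribution:
  fixes A :: "'i set"
  assumes A: "finite A" "A \<noteq> {}"
  shows "distr (\<Pi>\<^sub>M i\<in>A. (lborel :: real measure)) borel (\<lambda>f. sqrt (\<Sum>i\<in>A. (f i)\<^sup>2)) =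
    density lborel (\<lambda>r. ennreal (unit_ball_vol (card A) * card A * r ^ (card A - 1)) * indicator
        {0<..} r)"
    (is "?M = ?N")
proof -
  define m where "m = card A"
  have m: "m > 0"
    unfolding m_def using A by (simp add: card_gt_0_iff)
  have eq: "emeasure ?M {..r} = ennreal (unit_ball_vol m * r ^ m)" if "r > 0" for r
    using emeasure_cball_aux[OF A(1) that]
    by (subst emeasure_distr) (auto simp: vimage_def m_def)
  have le0: "emeasure ?M {..r} = 0" if "r \<le> 0" for r
  proof -
    have "emeasure ?M {..r} \<le> ennreal (unit_ball_vol m * e ^ m)" if "e > 0" for e
      using emeasure_mono[of "{..r}" "{..e}" ?M] \<open>r \<le> 0\<close> that by (simp add: eq)
    moreover have "((\<lambda>e. ennreal (unit_ball_vol m * e ^ m)) \<longlongrightarrow> ennreal (unit_ball_vol m * 0 ^ m))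
        (at_right 0)"
      by (intro tendsto_intros)
    ultimately have "emeasure ?M {..r} \<le> ennreal (unit_ball_vol m * 0 ^ m)"
      by (intro tendsto_lowerbound[of _ _ "at_right (0::real)"])
        (auto intro: eventually_mono[OF eventually_at_right_less])
    then show ?thesis using m by (simp add: power_0_left)
  qed
  have N: "emeasure ?N {..r} = emeasure ?M {..r}" for r
  proof (cases "r > 0")
    case True
    have "emeasure ?N {..r} =
        (\<integral>\<^sup>+x. ennreal (unit_ball_vol m * m * x ^ (m - 1)) * indicator {0<..} x * indicator {..r} x
            \<partial>lborel)"
      by (subst emeasure_density) (auto simp: m_def)
    also have "\<dots> = (\<integral>\<^sup>+x. ennreal (unit_ball_vol m * m * x ^ (m - 1)) * indicator {0..r} x \<partial>lborel)"
      by (intro nn_integral_cong_AE AE_I[of _ _ "{0}"]) (auto simp: indicator_def)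
    also have "\<dots> = ennreal (unit_ball_vol m * r ^ m - unit_ball_vol m * 0 ^ m)"
      using True m
      by (intro nn_integral_FTC_Icc) (auto intro!: derivative_eq_intros)
    finally show ?thesis
      using m by (simp add: eq[OF True] power_0_left)
  next
    case False
    then have "emeasure ?N {..r} = 0"
      by (subst emeasure_density) (auto simp: indicator_def nn_integral_0_iff_AE)
    then show ?thesis
      using False le0 by simp
  qed
  show ?thesis
  proof (rule measure_eqI_generator_eq[where E = "range (\<lambda>r. {..r})" and \<Omega> = UNIV and A =
      "\<lambda>n. {..real n}"])
    show "Int_stable (range (\<lambda>r::real. {..r}))"
      by (auto simp: Int_stable_def)
    show "(\<Union>n. {..real n}) = UNIV"
      using real_arch_simple by auto
    show "emeasure ?M {..real n} \<noteq> \<infinity>" for n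
      using eq[of "real n"] le0[of "real n"] by (cases "n = 0") auto
    show "sets ?M = sigma_sets UNIV (range (\<lambda>r. {..r}))" "sets ?N =
        sigma_sets UNIV (range (\<lambda>r. {..r}))"
      by (simp_all add: borel_eq_atMost)
  qed (use N[symmetric] in auto)
qed

text \<open>
  A point of the ball is written as \<open>(a, x')\<close> with \<open>a\<close> its component along the basis vector \<open>b\<close>.
  The integrand depends on \<open>a\<close> and \<open>r = norm x'\<close> only. The substitution \<open>a = r * y\<close> makes the
  direction depend on \<open>y\<close> alone, and the integral over \<open>r\<close> can then be evaluated.
\<close>
lemma nn_integral_ball_cos:
  fixes b :: "'a::euclidean_space" and F :: "real \<Rightarrow> ennreal"
  assumes b: "b \<in> Basis" and m: "DIM('a) =
      Suc m" "m > 0" and F [measurable]: "F \<in> borel_measurable borel"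
  shows "(\<integral>\<^sup>+x. F (sgn x \<bullet> b) * indicator (ball 0 1) x \<partial>lborel) =
    (\<integral>\<^sup>+y. F (y / sqrt (1 + y\<^sup>2)) * ennreal (unit_ball_vol m * m / (m + 1) / sqrt (1 + y\<^sup>2) ^ (m +
        1)) \<partial>lborel)"
proof -
  interpret product_sigma_finite "\<lambda>_. lborel :: real measure"
    by standard
  define A where "A = Basis - {b}"
  have A: "finite A" "b \<notin> A" "Basis = insert b A" "card A = m"
    using b m by (auto simp: A_def card_Diff_singleton)
  then have A_ne: "A \<noteq> {}"
    using m(2) by auto
  let ?K = "\<lambda>a r. F (a / sqrt (a\<^sup>2 + r\<^sup>2)) * indicator {..<1} (sqrt (a\<^sup>2 + r\<^sup>2))"
  let ?\<rho> = "\<lambda>f. sqrt (\<Sum>i\<in>A. (f i)\<^sup>2)"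
  let ?c = "\<lambda>r. ennreal (unit_ball_vol m * m * r ^ (m - 1)) * indicator {0<..} r"
  have [measurable]: "(\<lambda>x. F (sgn x \<bullet> b) * indicator (ball 0 1) x) \<in> borel_measurable borel"
    by (measurable, simp add: sgn_div_norm) measurable
  have point: "F (sgn x \<bullet> b) * indicator (ball 0 1) x = ?K (f b) (?\<rho> f)"
    if "x = (\<Sum>i\<in>Basis. f i *\<^sub>R i)" for x :: 'a and f
  proof -
    have c: "x \<bullet> i = f i" if "i \<in> Basis" for i
      using that \<open>x = _\<close> by simp
    have "norm x = sqrt (\<Sum>i\<in>Basis. (f i)\<^sup>2)"
      unfolding norm_eq_sqrt_inner euclidean_inner[of x x] by (simp add: c power2_eq_square)
    also have "(\<Sum>i\<in>Basis. (f i)\<^sup>2) = (f b)\<^sup>2 + (?\<rho> f)\<^sup>2"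
      unfolding A(3) using A(1,2) by (simp add: sum_nonneg)
    finally have "norm x = sqrt ((f b)\<^sup>2 + (?\<rho> f)\<^sup>2)" .
    then show ?thesis
      using c[OF b] by (simp add: sgn_div_norm indicator_def divide_inverse mult.commute)
  qed
  have "(\<integral>\<^sup>+x. F (sgn x \<bullet> b) * indicator (ball 0 1) x \<partial>lborel) =
      (\<integral>\<^sup>+f. ?K (f b) (?\<rho> f) \<partial>Pi\<^sub>M (insert b A) (\<lambda>_. lborel))"
    by (subst lborel_eq, subst nn_integral_distr) (simp_all add: point[OF refl] A(3)[symmetric])
  also have "\<dots> = (\<integral>\<^sup>+f. \<integral>\<^sup>+a. ?K a (?\<rho> f) \<partial>lborel \<partial>Pi\<^sub>M A (\<lambda>_. lborel))"
  proof (subst product_nn_integral_insert)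
    show "(\<lambda>f. ?K (f b) (?\<rho> f)) \<in> borel_measurable (Pi\<^sub>M (insert b A) (\<lambda>_. lborel))"
      by measurable
    show "(\<integral>\<^sup>+f. \<integral>\<^sup>+a. ?K ((f(b := a)) b) (?\<rho> (f(b := a))) \<partial>lborel \<partial>Pi\<^sub>M A (\<lambda>_. lborel)) =
        (\<integral>\<^sup>+f. \<integral>\<^sup>+a. ?K a (?\<rho> f) \<partial>lborel \<partial>Pi\<^sub>M A (\<lambda>_. lborel))"
      using A(2) by (intro nn_integral_cong) (auto intro!: sum.cong arg_cong[where f =
          "\<lambda>r. ?K _ (sqrt r)"])
  qed (use A(1,2) in auto)
  also have "\<dots> = (\<integral>\<^sup>+r. \<integral>\<^sup>+a. ?K a r \<partial>lborel \<partial>distr (Pi\<^sub>M A (\<lambda>_. lborel)) borel ?\<rho>)"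
    by (subst nn_integral_distr) auto
  also have "\<dots> = (\<integral>\<^sup>+r. ?c r * (\<integral>\<^sup>+a. ?K a r \<partial>lborel) \<partial>lborel)"
    unfolding radial_distribution[OF A(1) A_ne] A(4) by (subst nn_integral_density) auto
  also have "\<dots> = (\<integral>\<^sup>+r. \<integral>\<^sup>+y. F (y / sqrt (1 + y\<^sup>2)) *
      (ennreal (unit_ball_vol m * m * r ^ m) * indicator {0<..<1 / sqrt (1 + y\<^sup>2)} r) \<partial>lborel
          \<partial>lborel)"
  proof (intro nn_integral_cong)
    fix r :: real
    show "?c r * (\<integral>\<^sup>+a. ?K a r \<partial>lborel) = (\<integral>\<^sup>+y. F (y / sqrt (1 + y\<^sup>2)) *
        (ennreal (unit_ball_vol m * m * r ^ m) * indicator {0<..<1 / sqrt (1 + y\<^sup>2)} r) \<partial>lborel)"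
    proof (cases "r > 0")
      case True
      have k: "?K (0 + r * y) r = F (y / sqrt (1 + y\<^sup>2)) * indicator {0<..<1 / sqrt (1 + y\<^sup>2)} r"
          for y
      proof -
        have "(r * y)\<^sup>2 + r\<^sup>2 = r\<^sup>2 * (1 + y\<^sup>2)"
          by (simp add: power_mult_distrib distrib_left)
        then have "sqrt ((r * y)\<^sup>2 + r\<^sup>2) = r * sqrt (1 + y\<^sup>2)"
          using True by (simp add: real_sqrt_mult)
        moreover have "sqrt (1 + y\<^sup>2) > 0"
          by (simp add: add_pos_nonneg)
        ultimately show ?thesis
          using True by (auto simp: indicator_def pos_less_divide_eq)
      qed
      have "?c r * (\<integral>\<^sup>+a. ?K a r \<partial>lborel) = ?c r * (ennreal \<bar>r\<bar> * (\<integral>\<^sup>+y. ?K (0 + r * y) r \<partial>lborel))"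
        using True by (subst nn_integral_real_affine[of _ r 0]) auto
      also have "\<dots> = ?c r * ennreal \<bar>r\<bar> *
          (\<integral>\<^sup>+y. F (y / sqrt (1 + y\<^sup>2)) * indicator {0<..<1 / sqrt (1 + y\<^sup>2)} r \<partial>lborel)"
        unfolding k by (simp add: mult.assoc)
      also have "?c r * ennreal \<bar>r\<bar> = ennreal (unit_ball_vol m * m * r ^ m)"
        using True m(2) by (simp add: ennreal_mult'[symmetric] power_eq_if mult_ac)
      also have "ennreal (unit_ball_vol m * m * r ^ m) *
          (\<integral>\<^sup>+y. F (y / sqrt (1 + y\<^sup>2)) * indicator {0<..<1 / sqrt (1 + y\<^sup>2)} r \<partial>lborel) =
        (\<integral>\<^sup>+y. ennreal (unit_ball_vol m * m * r ^ m) *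
          (F (y / sqrt (1 + y\<^sup>2)) * indicator {0<..<1 / sqrt (1 + y\<^sup>2)} r) \<partial>lborel)"
        by (rule nn_integral_cmult[symmetric]) (measurable, simp only: greaterThanLessThan_iff,
            measurable)
      also have "\<dots> = (\<integral>\<^sup>+y. F (y / sqrt (1 + y\<^sup>2)) *
          (ennreal (unit_ball_vol m * m * r ^ m) * indicator {0<..<1 / sqrt (1 + y\<^sup>2)} r) \<partial>lborel)"
        by (simp only: mult.left_commute)
      finally show ?thesis .
    qed (simp add: indicator_def)
  qed
  also have "\<dots> = (\<integral>\<^sup>+y. \<integral>\<^sup>+r. F (y / sqrt (1 + y\<^sup>2)) *
      (ennreal (unit_ball_vol m * m * r ^ m) * indicator {0<..<1 / sqrt (1 + y\<^sup>2)} r) \<partial>lborel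
          \<partial>lborel)"
    by (rule lborel_pair.Fubini') (measurable, simp only: greaterThanLessThan_iff, measurable)
  also have "\<dots> = (\<integral>\<^sup>+y. F (y / sqrt (1 + y\<^sup>2)) *
      ennreal (unit_ball_vol m * m / (m + 1) / sqrt (1 + y\<^sup>2) ^ (m + 1)) \<partial>lborel)"
  proof (intro nn_integral_cong)
    fix y :: real
    define R where "R = 1 / sqrt (1 + y\<^sup>2)"
    have R: "R > 0"
      by (simp add: R_def add_pos_nonneg)
    have "(\<integral>\<^sup>+r. ennreal (unit_ball_vol m * m * r ^ m) * indicator {0<..<R} r \<partial>lborel) =
        (\<integral>\<^sup>+r. ennreal (unit_ball_vol m * m * r ^ m) * indicator {0..R} r \<partial>lborel)"
      by (intro nn_integral_cong_AE AE_I[of _ _ "{0, R}"])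
        (auto simp: indicator_def emeasure_lborel_countable)
    also have "\<dots> = ennreal (unit_ball_vol m * m / (m + 1) * R ^ (m + 1) -
        unit_ball_vol m * m / (m + 1) * 0 ^ (m + 1))"
    proof (rule nn_integral_FTC_Icc)
      show "((\<lambda>r. unit_ball_vol m * m / (m + 1) * r ^ (m + 1)) has_real_derivative unit_ball_vol m
          * m * x ^ m) (at x)" for x
        by (rule derivative_eq_intros refl)+ (simp add: field_simps)
    qed (use R in auto)
    finally show "(\<integral>\<^sup>+r. F (y / sqrt (1 + y\<^sup>2)) *
        (ennreal (unit_ball_vol m * m * r ^ m) * indicator {0<..<1 / sqrt (1 + y\<^sup>2)} r) \<partial>lborel) =
      F (y / sqrt (1 + y\<^sup>2)) * ennreal (unit_ball_vol m * m / (m + 1) / sqrt (1 + y\<^sup>2) ^ (m + 1))"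
      by (subst nn_integral_cmult) (simp_all add: R_def power_inverse divide_inverse mult_ac)
  qed
  finally show ?thesis .
qed

lemma tendsto_div_sqrt_at_top: "((\<lambda>y::real. y / sqrt (1 + y\<^sup>2)) \<longlongrightarrow> 1) at_top"
proof -
  have inv: "((\<lambda>y::real. inverse y) \<longlongrightarrow> 0) at_top"
    by (intro tendsto_inverse_0_at_top filterlim_ident)
  have "((\<lambda>y::real. 1 / sqrt ((inverse y)\<^sup>2 + 1)) \<longlongrightarrow> 1 / sqrt (0\<^sup>2 + 1)) at_top"
    by (intro tendsto_intros inv) auto
  moreover have "\<forall>\<^sub>F y in at_top. 1 / sqrt ((inverse y)\<^sup>2 + 1) = y / sqrt (1 + y\<^sup>2)"
    using eventually_gt_at_top[of "0::real"]
  proof eventually_elim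
    case (elim y)
    have "(inverse y)\<^sup>2 + 1 = (1 + y\<^sup>2) / y\<^sup>2"
      using elim by (simp add: field_simps)
    then show ?case
      using elim by (simp add: real_sqrt_divide)
  qed
  ultimately show ?thesis
    by (simp add: tendsto_cong)
qed

text \<open>The cone construction of the surface measure, in terms of integrals.\<close>
lemma nn_integral_sphere_measure:
  fixes g :: "'a::euclidean_space \<Rightarrow> ennreal"
  assumes [measurable]: "g \<in> borel_measurable borel"
  shows "(\<integral>\<^sup>+\<theta>. g \<theta> \<partial>sphere_measure) =
      of_nat DIM('a) * (\<integral>\<^sup>+x. g (sgn x) * indicator (ball 0 1) x \<partial>lborel)"
proof -
  have [measurable]: "g \<in> borel_measurable (restrict_space borel (sphere 0 1))"
    by (intro measurable_restrict_space1) measurable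
  have "(\<integral>\<^sup>+\<theta>. g \<theta> \<partial>sphere_measure) =
      of_nat DIM('a) * (\<integral>\<^sup>+x. g (sgn x) * indicator (ball 0 1 - {0}) x \<partial>lborel)"
    unfolding sphere_measure_def
    by (subst nn_integral_scale_measure, simp)
      (simp add: nn_integral_distr[OF sgn_measurable_sphere] nn_integral_restrict_space)
  also have "(\<integral>\<^sup>+x. g (sgn x) * indicator (ball 0 1 - {0}) x \<partial>lborel) =
      (\<integral>\<^sup>+x. g (sgn x) * indicator (ball 0 1) x \<partial>lborel)"
    by (intro nn_integral_cong_AE AE_I[of _ _ "{0}"]) (auto simp: indicator_def)
  finally show ?thesis .
qed

text \<open>The vector \<open>p\<close> is moved to a basis vector by an orthogonal map.\<close>
lemma nn_integral_sphere_cos: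
  fixes p :: "real ^ 'n" and F :: "real \<Rightarrow> ennreal"
  assumes p: "norm p = 1" and m: "CARD('n) =
      Suc m" "m > 0" and F [measurable]: "F \<in> borel_measurable borel"
  shows "(\<integral>\<^sup>+\<theta>. F (\<theta> \<bullet> p) \<partial>sphere_measure) =
    (\<integral>\<^sup>+y. F (y / sqrt (1 + y\<^sup>2)) * ennreal (sphere_area m / sqrt (1 + y\<^sup>2) ^ (m + 1)) \<partial>lborel)"
proof -
  define b :: "real ^ 'n" where "b = axis undefined 1"
  have b: "b \<in> Basis"
    by (simp add: b_def axis_in_Basis_iff)
  obtain T where T: "orthogonal_transformation T" "T b = p"
    using orthogonal_transformation_exists[of b p] p b by auto
  have lin: "linear T"
    using T(1) by (rule orthogonal_transformation_linear)
  have T_meas [measurable]: "T \<in> borel_measurable borel"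
    using lin by (intro borel_measurable_continuous_onI linear_continuous_on
        linear_conv_bounded_linear[THEN iffD1])
  have [measurable]: "(sgn :: real ^ 'n \<Rightarrow> real ^ 'n) \<in> borel_measurable borel"
    unfolding sgn_div_norm[abs_def] by measurable
  have [measurable]: "(\<lambda>x. F (sgn x \<bullet> p) * indicator (ball 0 1) x) \<in> borel_measurable borel"
    by (intro borel_measurable_times_ennreal borel_measurable_indicator; measurable?; simp)
  have inner: "sgn (T x) \<bullet> p = sgn x \<bullet> b" for x
    using T by (simp add: sgn_div_norm orthogonal_transformation_norm
        orthogonal_transformation_def flip: T(2))
  have c: "of_nat (Suc m) * ennreal (unit_ball_vol m * m / (m + 1) / sqrt (1 + y\<^sup>2) ^ (m + 1)) =
      ennreal (sphere_area m / sqrt (1 + y\<^sup>2) ^ (m + 1))" for y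
  proof -
    have "real (Suc m) * (unit_ball_vol m * m / (m + 1) / sqrt (1 + y\<^sup>2) ^ (m + 1)) =
        sphere_area m / sqrt (1 + y\<^sup>2) ^ (m + 1)"
      by (simp add: sphere_area_def divide_simps)
    then show ?thesis
      by (metis ennreal_mult' ennreal_of_nat_eq_real_of_nat of_nat_0_le_iff)
  qed
  have "(\<integral>\<^sup>+\<theta>. F (\<theta> \<bullet> p) \<partial>sphere_measure) =
      of_nat (Suc m) * (\<integral>\<^sup>+x. F (sgn x \<bullet> p) * indicator (ball 0 1) x \<partial>lborel)"
    by (subst nn_integral_sphere_measure) (simp_all add: m)
  also have "(\<integral>\<^sup>+x. F (sgn x \<bullet> p) * indicator (ball 0 1) x \<partial>lborel) =
      (\<integral>\<^sup>+x. F (sgn (T x) \<bullet> p) * indicator (ball 0 1) (T x) \<partial>lborel)"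
    by (subst lborel_distr_orthogonal[OF T(1), symmetric], subst nn_integral_distr) simp_all
  also have "\<dots> = (\<integral>\<^sup>+x. F (sgn x \<bullet> b) * indicator (ball 0 1) x \<partial>lborel)"
    unfolding inner by (intro nn_integral_cong)
        (simp add: indicator_def orthogonal_transformation_norm[OF T(1)])
  also have "\<dots> = (\<integral>\<^sup>+y. F (y / sqrt (1 + y\<^sup>2)) *
      ennreal (unit_ball_vol m * m / (m + 1) / sqrt (1 + y\<^sup>2) ^ (m + 1)) \<partial>lborel)"
    using m by (intro nn_integral_ball_cos b F) auto
  also have "of_nat (Suc m) * \<dots> = (\<integral>\<^sup>+y. F (y / sqrt (1 + y\<^sup>2)) *
      (of_nat (Suc m) * ennreal (unit_ball_vol m * m / (m + 1) / sqrt (1 + y\<^sup>2) ^ (m + 1))) \<partial>lborel)"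
    by (subst nn_integral_cmult[symmetric]) (auto simp: mult_ac)
  finally show ?thesis unfolding c .
qed

text \<open>
  The substitution \<open>s = y / sqrt (1 + y\<^sup>2)\<close> in \<open>nn_integral_sphere_cos\<close>; it maps the real line onto
  \<open>(-1, 1)\<close>, with \<open>1 - s\<^sup>2 = 1 / (1 + y\<^sup>2)\<close> and \<open>ds = (1 + y\<^sup>2)\<^sup>-\<^sup>3\<^sup>/\<^sup>2 dy\<close>.
\<close>
lemma integral_sphere_cos_nonneg:
  fixes p :: "real ^ 'n" and F :: "real \<Rightarrow> real"
  assumes p: "norm p = 1" and k: "CARD('n) = 2 * k + 3"
    and F: "continuous_on UNIV F" "\<And>s. 0 \<le> F s" "\<And>s. F s \<le> B"
  shows "integrable (sphere_measure :: (real ^ 'n) measure) (\<lambda>\<theta>. F (\<theta> \<bullet> p))"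
    and "(\<integral>\<theta>. F (\<theta> \<bullet> p) \<partial>sphere_measure) =
      sphere_area (2 * k + 2) * integral {-1..1} (\<lambda>s. F s * (1 - s\<^sup>2) ^ k)"
proof -
  let ?\<sigma> = "sphere_measure :: (real ^ 'n) measure"
  define g g' where "g = (\<lambda>y::real. y / sqrt (1 + y\<^sup>2))" and "g' = (\<lambda>y::real. 1 / sqrt (1 + y\<^sup>2) ^ 3)"
  define f where "f = (\<lambda>s. F s * (1 - s\<^sup>2) ^ k)"
  define a where "a = sphere_area (2 * k + 2)"
  have a: "a > 0"
    by (simp add: a_def sphere_area_def)
  have Fb [measurable]: "F \<in> borel_measurable borel"
    using F(1) by (rule borel_measurable_continuous_onI)
  have meas [measurable]: "(\<lambda>\<theta>. F (\<theta> \<bullet> p)) \<in> borel_measurable ?\<sigma>"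
  proof -
    have "(\<lambda>\<theta>. F (\<theta> \<bullet> p)) \<in> borel_measurable (restrict_space borel (sphere 0 1))"
      by (intro measurable_restrict_space1) measurable
    then show ?thesis
      using measurable_cong_sets[OF sets_sphere_measure refl] by blast
  qed
  have sq: "0 < 1 + y\<^sup>2" "1 + y\<^sup>2 \<noteq> 0" for y :: real
    using zero_le_power2[of y] by linarith+
  have fg: "f (g y) * g' y = F (g y) / sqrt (1 + y\<^sup>2) ^ (2 * k + 3)" for y
  proof -
    have "1 - (g y)\<^sup>2 = 1 / (sqrt (1 + y\<^sup>2))\<^sup>2"
      using sq[of y] by (simp add: g_def power_divide divide_simps)
    then show ?thesis
      using sq[of y] by (simp add: f_def g'_def power_one_over power_add power_mult)
  qed
  have nonneg: "0 \<le> f (g y) * g' y" for y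
    unfolding fg using F(2) by simp
  have nn: "(\<integral>\<^sup>+\<theta>. ennreal (F (\<theta> \<bullet> p)) \<partial>?\<sigma>) = ennreal a * (\<integral>\<^sup>+y. ennreal (f (g y) * g' y) \<partial>lborel)"
  proof -
    have "(\<integral>\<^sup>+\<theta>. ennreal (F (\<theta> \<bullet> p)) \<partial>?\<sigma>) =
        (\<integral>\<^sup>+y. ennreal (F (g y)) * ennreal (a / sqrt (1 + y\<^sup>2) ^ (2 * k + 3)) \<partial>lborel)"
      using nn_integral_sphere_cos[OF p, of "2 * k + 2" "\<lambda>s. ennreal (F s)"] k
      by (simp add: g_def a_def eval_nat_numeral)
    also have "\<dots> = (\<integral>\<^sup>+y. ennreal a * ennreal (f (g y) * g' y) \<partial>lborel)"
      unfolding fg using F(2) a by (intro nn_integral_cong)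
          (simp add: ennreal_mult'[symmetric] mult.commute)
    also have "\<dots> = ennreal a * (\<integral>\<^sup>+y. ennreal (f (g y) * g' y) \<partial>lborel)"
      by (rule nn_integral_cmult) (unfold f_def g_def g'_def, measurable)
    finally show ?thesis .
  qed
  have fin: "(\<integral>\<^sup>+\<theta>. ennreal (F (\<theta> \<bullet> p)) \<partial>?\<sigma>) < \<infinity>"
  proof -
    have "emeasure ?\<sigma> (space ?\<sigma>) \<noteq> \<infinity>"
    proof -
      have "(\<integral>\<^sup>+\<theta>. 1 \<partial>?\<sigma>) = of_nat DIM(real ^ 'n) * emeasure lborel (ball (0 :: real ^ 'n) 1)"
        by (subst nn_integral_sphere_measure) auto
      then show ?thesis
        by (simp add: emeasure_ball ennreal_mult_eq_top_iff)
    qed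
    moreover have "(\<integral>\<^sup>+\<theta>. ennreal (F (\<theta> \<bullet> p)) \<partial>?\<sigma>) \<le> (\<integral>\<^sup>+\<theta>. ennreal B \<partial>?\<sigma>)"
      using F(3) by (intro nn_integral_mono ennreal_leI)
    ultimately show ?thesis
      by (simp add: ennreal_mult_less_top less_top le_less_trans)
  qed
  show int: "integrable ?\<sigma> (\<lambda>\<theta>. F (\<theta> \<bullet> p))"
    using fin F(2) by (intro integrableI_nonneg) auto
  have int_fg: "integrable lborel (\<lambda>y. f (g y) * g' y)"
  proof (rule integrableI_nonneg)
    show "(\<lambda>y. f (g y) * g' y) \<in> borel_measurable lborel"
      unfolding f_def g_def g'_def by measurable
    show "(\<integral>\<^sup>+y. ennreal (f (g y) * g' y) \<partial>lborel) < \<infinity>"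
      using fin a unfolding nn by (auto simp: ennreal_mult_less_top)
  qed (use nonneg in auto)
  have cont_f: "isCont f s" for s
    unfolding f_def using F(1) by (intro continuous_intros)
        (auto simp: continuous_on_eq_continuous_at)
  have lim: "(g \<longlongrightarrow> -1) at_bot" "(g \<longlongrightarrow> 1) at_top"
    unfolding g_def filterlim_at_bot_mirror
    using tendsto_div_sqrt_at_top tendsto_minus[OF tendsto_div_sqrt_at_top] by simp_all
  have subst: "(LBINT s=-1..1. f s) = (LBINT y=-\<infinity>..\<infinity>. f (g y) * g' y)"
  proof (rule interval_integral_substitution_nonneg(2)[where g = g and a = "-\<infinity>" and b = "\<infinity>"])
    show "(g has_real_derivative g' y) (at y)" for y
      unfolding g_def g'_def using sq[of y]
      by (auto intro!: derivative_eq_intros simp: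
          divide_simps power3_eq_cube power2_eq_square[of y])
    show "isCont g' y" for y
      unfolding g'_def using sq[of y] by (intro continuous_intros) auto
    show "((ereal \<circ> g \<circ> real_of_ereal) \<longlongrightarrow> - 1) (at_right (- \<infinity>))"
      using tendsto_ereal[OF lim(1)] unfolding ereal_tendsto_simps
      by (simp add: one_ereal_def o_def)
    show "((ereal \<circ> g \<circ> real_of_ereal) \<longlongrightarrow> 1) (at_left \<infinity>)"
      using tendsto_ereal[OF lim(2)] unfolding ereal_tendsto_simps
      by (simp add: one_ereal_def o_def)
    show "set_integrable lborel (einterval (- \<infinity>) \<infinity>) (\<lambda>x. f (g x) * g' x)"
      using int_fg by (simp add: set_integrable_def)
  qed (use cont_f F(2) sq in \<open>auto simp:
      f_def g'_def g_def power_divide divide_simps intro!: mult_nonneg_nonneg zero_le_power\<close>)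
  have "(\<integral>\<theta>. F (\<theta> \<bullet> p) \<partial>?\<sigma>) = enn2real (\<integral>\<^sup>+\<theta>. ennreal (F (\<theta> \<bullet> p)) \<partial>?\<sigma>)"
    using F(2) by (intro integral_eq_nn_integral) auto
  also have "(\<integral>\<^sup>+y. ennreal (f (g y) * g' y) \<partial>lborel) = ennreal (\<integral>y. f (g y) * g' y \<partial>lborel)"
    using int_fg nonneg by (intro nn_integral_eq_integral) auto
  then have "enn2real (\<integral>\<^sup>+\<theta>. ennreal (F (\<theta> \<bullet> p)) \<partial>?\<sigma>) = a * (\<integral>y. f (g y) * g' y \<partial>lborel)"
    unfolding nn using a nonneg by (simp add: enn2real_mult)
  also have "(\<integral>y. f (g y) * g' y \<partial>lborel) = (LBINT y=-\<infinity>..\<infinity>. f (g y) * g' y)"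
    by (simp add: interval_lebesgue_integral_def set_lebesgue_integral_def)
  also have "\<dots> = (LBINT s=-1..1. f s)"
    by (rule subst[symmetric])
  also have "\<dots> = integral {-1..1} f"
    using interval_integral_eq_integral[of "-1" 1 f] cont_f
    by (simp add: borel_integrable_atLeastAtMost' continuous_at_imp_continuous_on one_ereal_def)
  finally show "(\<integral>\<theta>. F (\<theta> \<bullet> p) \<partial>sphere_measure) =
      sphere_area (2 * k + 2) * integral {-1..1} (\<lambda>s. F s * (1 - s\<^sup>2) ^ k)"
    by (simp add: a_def f_def)
qed

text \<open>Adding a constant reduces a bounded function to the nonnegative case.\<close>
lemma integral_sphere_cos:
  fixes p :: "real ^ 'n" and F :: "real \<Rightarrow> real"
  assumes p: "norm p = 1" and k: "CARD('n) = 2 * k + 3"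
    and F: "continuous_on UNIV F" "\<And>s. \<bar>F s\<bar> \<le> B"
  shows "(\<integral>\<theta>. F (\<theta> \<bullet> p) \<partial>sphere_measure) =
    sphere_area (2 * k + 2) * integral {-1..1} (\<lambda>s. F s * (1 - s\<^sup>2) ^ k)"
proof -
  have B: "0 \<le> B"
    using F(2)[of 0] by linarith
  have F': "0 \<le> F s + B" "F s + B \<le> 2 * B" for s
    using F(2)[of s] by linarith+
  have cont: "continuous_on UNIV (\<lambda>s. F s + B)"
    by (intro continuous_intros F(1))
  let ?\<sigma> = "sphere_measure :: (real ^ 'n) measure"
  note 1 = integral_sphere_cos_nonneg[OF p k cont F']
    and 2 = integral_sphere_cos_nonneg[where F = "\<lambda>_. B" and B =
        B, OF p k continuous_on_const B order_refl]
  have i: "(\<lambda>s. G s * (1 - s\<^sup>2) ^ k) integrable_on {-1..1}" if "continuous_on UNIV G"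
      for G :: "real \<Rightarrow> real"
    by (intro integrable_continuous_interval continuous_intros continuous_on_subset[OF that]) auto
  have "(\<integral>\<theta>. F (\<theta> \<bullet> p) \<partial>?\<sigma>) =
      (\<integral>\<theta>. (F (\<theta> \<bullet> p) + B) - B \<partial>?\<sigma>)"
    by simp
  also have "\<dots> = (\<integral>\<theta>. F (\<theta> \<bullet> p) + B \<partial>?\<sigma>) - (\<integral>\<theta>. B \<partial>?\<sigma>)"
    by (rule Bochner_Integration.integral_diff[OF 1(1) 2(1)])
  also have "\<dots> = sphere_area (2 * k + 2) *
      (integral {-1..1} (\<lambda>s. (F s + B) * (1 - s\<^sup>2) ^ k) - integral {-1..1} (\<lambda>s. B * (1 - s\<^sup>2) ^ k))"
    unfolding 1(2) 2(2) by (simp add: right_diff_distrib)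
  also have "integral {-1..1} (\<lambda>s. (F s + B) * (1 - s\<^sup>2) ^ k) -
      integral {-1..1} (\<lambda>s. B * (1 - s\<^sup>2) ^ k) =
      integral {-1..1} (\<lambda>s. F s * (1 - s\<^sup>2) ^ k)"
    by (subst integral_diff[symmetric], rule i[OF cont], rule i[OF continuous_on_const])
      (simp add: algebra_simps)
  finally show ?thesis .
qed

section \<open>Spherical means of radial functions\<close>

text \<open>
  The absolute value under the root does nothing for \<open>s \<in> [-1, 1]\<close>; it makes the integrand a
  continuous function on the whole real line.
\<close>
lemma spherical_mean_radial:
  fixes f :: "real ^ 'n \<Rightarrow> real" and p :: "real ^ 'n"
  assumes p: "norm p = 1" and k: "CARD('n) = 2 * k + 3"
    and f: "continuous_on UNIV f" "\<And>x. \<bar>f x\<bar> \<le> B" and rad: "\<And>x. f x = \<phi> (norm x)"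
  shows "spherical_mean f p t = sphere_area (2 * k + 2) / sphere_area (2 * k + 3) *
    integral {-1..1} (\<lambda>s. \<phi> (sqrt \<bar>1 + t\<^sup>2 + 2 * t * s\<bar>) * (1 - s\<^sup>2) ^ k)"
proof -
  define F where "F = (\<lambda>s. \<phi> (sqrt \<bar>1 + t\<^sup>2 + 2 * t * s\<bar>))"
  have F_eq: "F s = f (sqrt \<bar>1 + t\<^sup>2 + 2 * t * s\<bar> *\<^sub>R p)" for s
    using p by (simp add: F_def rad)
  have "continuous_on UNIV F"
    unfolding F_eq[abs_def] by (intro continuous_on_compose2[OF f(1)] continuous_intros) auto
  moreover have "\<bar>F s\<bar> \<le> B" for s
    unfolding F_eq by (rule f(2))
  ultimately have int: "(\<integral>\<theta>. F (\<theta> \<bullet> p) \<partial>sphere_measure) =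
      sphere_area (2 * k + 2) * integral {-1..1} (\<lambda>s. F s * (1 - s\<^sup>2) ^ k)"
    by (rule integral_sphere_cos[OF p k])
  have "f (p + t *\<^sub>R \<theta>) = F (\<theta> \<bullet> p)" if "norm \<theta> = 1" for \<theta>
  proof -
    have "(norm (p + t *\<^sub>R \<theta>))\<^sup>2 = 1 + t\<^sup>2 + 2 * t * (\<theta> \<bullet> p)"
      unfolding power2_norm_eq_inner
      using p that by (simp add: inner_simps norm_eq_1 power2_eq_square inner_commute)
    then have "norm (p + t *\<^sub>R \<theta>) = sqrt \<bar>1 + t\<^sup>2 + 2 * t * (\<theta> \<bullet> p)\<bar>"
      by (metis abs_of_nonneg norm_ge_zero real_sqrt_unique zero_le_power2)
    then show ?thesis
      by (simp add: F_def rad)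
  qed
  then have "(\<integral>\<theta>. f (p + t *\<^sub>R \<theta>) \<partial>sphere_measure) = (\<integral>\<theta>. F (\<theta> \<bullet> p) \<partial>sphere_measure)"
    by (intro Bochner_Integration.integral_cong) auto
  then show ?thesis
    unfolding spherical_mean_def measure_sphere_measure int using k by (simp add: F_def)
qed

text \<open>
  The substitution \<open>r\<^sup>2 = 1 + t\<^sup>2 + 2 * t * s\<close>, so that \<open>r dr = t ds\<close>. The condition \<open>t < 1\<close> keeps
  \<open>r\<close> away from \<open>0\<close>, where \<open>\<phi>\<close> need not be continuous.
\<close>
lemma integral_substitution_distance:
  assumes \<phi>: "continuous_on {0<..} \<phi>" and t: "t \<in> {0<..<1}"
  shows "4 ^ k * t ^ (2 * k + 1) * integral {-1..1} (\<lambda>s. \<phi> (sqrt \<bar>1 + t\<^sup>2 + 2 * t * s\<bar>) * (1 - s\<^sup>2)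
      ^ k) =
    integral {1 - t..1 + t} (\<lambda>r. r * \<phi> r * mean_kernel r t ^ k)"
proof -
  define g where "g = (\<lambda>s. sqrt (1 + t\<^sup>2 + 2 * t * s))"
  let ?f = "\<lambda>r. r * \<phi> r * mean_kernel r t ^ k"
  have pos: "0 < 1 + t\<^sup>2 + 2 * t * s" if "s \<in> {-1..1}" for s
  proof -
    have "0 < (1 - t)\<^sup>2" using t by simp
    also have "\<dots> = 1 + t\<^sup>2 + 2 * t * (-1)" by (simp add: power2_eq_square algebra_simps)
    also have "\<dots> \<le> 1 + t\<^sup>2 + 2 * t * s"
      using t that by (intro add_left_mono mult_left_mono) auto
    finally show ?thesis .
  qed
  have "1 + t\<^sup>2 + 2 * t * (-1) = (1 - t)\<^sup>2" "1 + t\<^sup>2 + 2 * t * 1 = (1 + t)\<^sup>2"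
    by (simp_all add: power2_eq_square algebra_simps)
  then have ends: "g (-1) = 1 - t" "g 1 = 1 + t"
    using t by (simp_all only: g_def real_sqrt_abs) auto
  have "((\<lambda>s. (t / g s) *\<^sub>R ?f (g s)) has_integral integral {g (-1)..g 1} ?f) {-1..1}"
  proof (rule has_integral_substitution[where f = ?f and g = g and g' = "\<lambda>s. t / g s"
        and c = "1 - t" and d = "1 + t"])
    have "g s \<in> {g (-1)..g 1}" if "s \<in> {-1..1}" for s
      using that t mult_left_mono[of "-1" s t] mult_left_mono[of s 1 t]
        by (simp add: g_def mult.commute)
    then show "g ` {-1..1} \<subseteq> {1 - t..1 + t}"
      unfolding ends by blast
    show "continuous_on {1 - t..1 + t} ?f"
      using t by (intro continuous_intros continuous_on_mean_kernel continuous_on_subset[OF \<phi>]) auto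
    show "(g has_real_derivative t / g s) (at s within {-1..1})" if "s \<in> {-1..1}" for s
      unfolding g_def using pos[OF that]
      by (auto intro!: derivative_eq_intros simp: divide_simps)
  qed (use ends t in auto)
  moreover have "(t / g s) *\<^sub>R ?f (g s) =
      4 ^ k * t ^ (2 * k + 1) * (\<phi> (sqrt \<bar>1 + t\<^sup>2 + 2 * t * s\<bar>) * (1 - s\<^sup>2) ^ k)"
    if "s \<in> {-1..1}" for s
  proof -
    have g: "g s > 0" "(g s)\<^sup>2 = 1 + t\<^sup>2 + 2 * t * s" "sqrt \<bar>1 + t\<^sup>2 + 2 * t * s\<bar> = g s"
      using pos[OF that] by (simp_all add: g_def)
    have "mean_kernel (g s) t = 4 * t\<^sup>2 * (1 - s\<^sup>2)"
      unfolding mean_kernel_def g(2) by (simp add: power2_eq_square algebra_simps)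
    then have "mean_kernel (g s) t ^ k = 4 ^ k * t ^ (2 * k) * (1 - s\<^sup>2) ^ k"
      by (simp add: power_mult_distrib power_mult)
    then show ?thesis
      using g(1) unfolding g(3) by simp
  qed
  ultimately have "((\<lambda>s. 4 ^ k * t ^ (2 * k + 1) * (\<phi> (sqrt \<bar>1 + t\<^sup>2 + 2 * t * s\<bar>) * (1 - s\<^sup>2) ^ k))
      has_integral integral {1 - t..1 + t} ?f) {-1..1}"
    unfolding ends by (rule has_integral_eq[rotated])
  from integral_unique[OF this] show ?thesis
    by (simp only: integral_mult_right)
qed

proposition spherical_mean_radial_conv_kernel_integral:
  fixes f :: "real ^ 'n \<Rightarrow> real" and p :: "real ^ 'n"
  assumes p: "norm p = 1" and k: "CARD('n) = 2 * k + 3"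
    and f: "continuous_on UNIV f" "\<And>x. \<bar>f x\<bar> \<le> B" and rad: "\<And>x. f x = \<phi> (norm x)"
    and \<phi>: "continuous_on {0<..} \<phi>" "\<And>r. r \<ge> 1 \<Longrightarrow> \<phi> r = 0" and t: "t \<in> {0<..<1}"
  shows "4 ^ k * sphere_area (2 * k + 3) * t ^ (2 * k + 1) / sphere_area (2 * k + 2)
      * spherical_mean f p t =
    kernel_integral k (\<lambda>r. r * \<phi> r) t"
proof -
  have area: "sphere_area (2 * k + 3) > 0" "sphere_area (2 * k + 2) > 0"
    by (simp_all add: sphere_area_def)
  let ?f = "\<lambda>r. r * \<phi> r * mean_kernel r t ^ k"
  have "4 ^ k * sphere_area (2 * k + 3) * t ^ (2 * k + 1) / sphere_area (2 * k + 2)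
      * spherical_mean f p t =
      4 ^ k * t ^ (2 * k + 1) * integral {-1..1} (\<lambda>s. \<phi> (sqrt \<bar>1 + t\<^sup>2 + 2 * t * s\<bar>) * (1 - s\<^sup>2) ^ k)"
    using area by (simp add: spherical_mean_radial[OF p k f rad])
  also have "\<dots> = integral {1 - t..1 + t} ?f"
    by (rule integral_substitution_distance[OF \<phi>(1) t])
  also have "\<dots> = integral {1 - t..1} ?f + integral {1..1 + t} ?f"
    using t by (intro Henstock_Kurzweil_Integration.integral_combine[symmetric]
        integrable_continuous_interval
        continuous_intros continuous_on_mean_kernel continuous_on_subset[OF \<phi>(1)]) auto
  also have "integral {1..1 + t} ?f = integral {1..1 + t} (\<lambda>_. 0)"
    using \<phi>(2) by (intro integral_cong) simp
  finally show ?thesis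
    by (simp add: kernel_integral_def)
qed

section \<open>Uniqueness for the initial value problem\<close>

lemma L_op_diff:
  assumes S: "open S" "0 \<notin> S" and "C_k_on k S F" "C_k_on k S G" "s \<in> S"
  shows "L_op k (\<lambda>r. F r - G r) s = L_op k F s - L_op k G s"
proof -
  have "(D_op ^^ m) (\<lambda>r. F r - G r) s = (D_op ^^ m) F s - (D_op ^^ m) G s" if "m \<le> k" for m
    using D_op_funpow_lincomb[OF S, of m F G s 1 "-1"] C_k_on_le[OF _ that] assms by simp
  then show ?thesis
    unfolding L_op_conv_bessel_sum bessel_sum_def sum_subtractf[symmetric]
    by (intro sum.cong refl) (simp add: right_diff_distrib)
qed

text \<open>
  The function has a zero of order at least \<open>m\<close> at \<open>a\<close>: its derivatives of order less than \<open>m\<close>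
  vanish there. This property survives multiplication by an \<open>m\<close> times continuously differentiable
  function, and \<open>D\<close> lowers the order by at most one; so it carries initial conditions over from a
  function \<open>d\<close> to the functions \<open>D\<^sup>i(r\<^sup>2\<^sup>k\<^sup>+\<^sup>1 d)\<close>.
\<close>
definition vanishes_to_order :: "nat \<Rightarrow> real \<Rightarrow> (real \<Rightarrow> real) \<Rightarrow> bool" where
  "vanishes_to_order m a g \<longleftrightarrow> (\<forall>i<m. (deriv ^^ i) g a = 0)"

lemma vanishes_to_order_0 [simp]: "vanishes_to_order 0 a g"
  by (simp add: vanishes_to_order_def)

lemma vanishes_to_order_Suc: "vanishes_to_order (Suc m) a g \<longleftrightarrow> g a =
  0 \<and> vanishes_to_order m a (deriv g)"
proof -
  have "(deriv ^^ Suc i) g = (deriv ^^ i) (deriv g)" for i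
    by (simp only: funpow_Suc_right o_apply)
  then show ?thesis
    unfolding vanishes_to_order_def by (simp only: All_less_Suc2 funpow_0)
qed

lemma vanishes_to_order_SucD: "vanishes_to_order (Suc m) a g \<Longrightarrow> vanishes_to_order m a g"
  by (simp add: vanishes_to_order_def)

lemma vanishes_to_order_cong:
  assumes "open S" "a \<in> S"
  shows "(\<And>x. x \<in> S \<Longrightarrow> f x = g x) \<Longrightarrow> vanishes_to_order m a f = vanishes_to_order m a g"
proof (induction m arbitrary: f g)
  case (Suc m)
  have "deriv f x = deriv g x" if "x \<in> S" for x
    using Suc.prems that assms(1) by (intro deriv_cong_ev)
        (auto simp: eventually_nhds intro!: exI[of _ S])
  then have "vanishes_to_order m a (deriv f) = vanishes_to_order m a (deriv g)"
    by (rule Suc.IH)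
  moreover have "f a = g a"
    by (rule Suc.prems[OF assms(2)])
  ultimately show ?case
    by (simp add: vanishes_to_order_Suc)
qed simp

lemma vanishes_to_order_add:
  assumes "open S" "a \<in> S"
  shows "C_k_on m S f \<Longrightarrow> C_k_on m S g \<Longrightarrow> vanishes_to_order m a f \<Longrightarrow> vanishes_to_order m a g \<Longrightarrow>
    vanishes_to_order m a (\<lambda>x. f x + g x)"
proof (induction m arbitrary: f g)
  case (Suc m)
  have d: "deriv (\<lambda>x. f x + g x) x = deriv f x + deriv g x" if "x \<in> S" for x
    using Suc.prems that by (intro DERIV_imp_deriv DERIV_add C_k_on_DERIV) auto
  have "vanishes_to_order m a (\<lambda>x. deriv f x + deriv g x)"
    using Suc by (auto simp: vanishes_to_order_Suc C_k_on_Suc)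
  with Suc.prems show ?case
    using vanishes_to_order_cong[OF assms d] by (simp add: vanishes_to_order_Suc)
qed simp

lemma vanishes_to_order_mult:
  assumes "open S" "a \<in> S"
  shows "C_k_on m S c \<Longrightarrow> C_k_on m S g \<Longrightarrow> vanishes_to_order m a g \<Longrightarrow>
      vanishes_to_order m a (\<lambda>x. c x * g x)"
proof (induction m arbitrary: c g)
  case (Suc m)
  have d: "deriv (\<lambda>x. c x * g x) x = deriv c x * g x + c x * deriv g x" if "x \<in> S" for x
    using DERIV_imp_deriv[OF DERIV_mult[OF C_k_on_DERIV[OF Suc.prems(1) that]
        C_k_on_DERIV[OF Suc.prems(2) that]]]
    by (simp add: mult.commute)
  have "vanishes_to_order m a (\<lambda>x. deriv c x * g x + c x * deriv g x)"
  proof -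
    have "C_k_on m S c" "C_k_on m S g" "C_k_on m S (deriv c)" "C_k_on m S (deriv g)"
      "vanishes_to_order m a g" "vanishes_to_order m a (deriv g)"
      using Suc.prems C_k_on_SucD vanishes_to_order_SucD by (auto simp:
          C_k_on_Suc vanishes_to_order_Suc)
    with Suc.IH assms(1) show ?thesis
      by (intro vanishes_to_order_add[OF assms] C_k_on_mult) auto
  qed
  with Suc.prems show ?case
    using vanishes_to_order_cong[OF assms d] by (simp add: vanishes_to_order_Suc)
qed simp

lemma vanishes_to_order_D_op:
  assumes "open S" "a \<in> S" "0 \<notin> S" "C_k_on (Suc m) S g" "vanishes_to_order (Suc m) a g"
  shows "vanishes_to_order m a (D_op g)"
  unfolding D_op_def[abs_def] using assms
  by (intro vanishes_to_order_mult C_k_on_divide) (auto simp: vanishes_to_order_Suc C_k_on_Suc)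

lemma vanishes_to_order_D_op_funpow:
  assumes "open S" "a \<in> S" "0 \<notin> S"
  shows "C_k_on (m + j) S g \<Longrightarrow> vanishes_to_order (m + j) a g \<Longrightarrow> vanishes_to_order m a ((D_op ^^ j) g)"
proof (induction j arbitrary: m)
  case (Suc j)
  then show ?case
    using vanishes_to_order_D_op[OF assms, of m "(D_op ^^ j) g"] C_k_on_D_op_funpow[OF assms(1,3),
        of "Suc m" j g]
    by simp
qed simp

text \<open>Gronwall's inequality in both directions from the point \<open>s0\<close>, for zero initial value.\<close>
lemma gronwall_zero:
  fixes N :: "real \<Rightarrow> real"
  assumes d: "\<And>s. s \<in> {a..b} \<Longrightarrow> (N has_real_derivative N' s) (at s)"
    and bound: "\<And>s. s \<in> {a..b} \<Longrightarrow> \<bar>N' s\<bar> \<le> C * N s"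
    and nonneg: "\<And>s. s \<in> {a..b} \<Longrightarrow> 0 \<le> N s"
    and s0: "s0 \<in> {a..b}" "N s0 = 0" and s: "s \<in> {a..b}"
  shows "N s = 0"
proof (cases "s0 \<le> s")
  case True
  let ?E = "\<lambda>s. N s * exp (- C * s)"
  have "?E s \<le> ?E s0"
  proof (rule DERIV_nonpos_imp_nonincreasing[where f = ?E, OF True])
    fix x assume "s0 \<le> x" "x \<le> s"
    then have x: "x \<in> {a..b}" using s0 s by auto
    have "(?E has_real_derivative (N' x - C * N x) * exp (- C * x)) (at x)"
      by (auto intro!: derivative_eq_intros d[OF x] simp: algebra_simps)
    moreover have "(N' x - C * N x) * exp (- C * x) \<le> 0"
      using bound[OF x] by (intro mult_nonpos_nonneg) auto
    ultimately show "\<exists>y. (?E has_real_derivative y) (at x) \<and> y \<le> 0" by blast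
  qed
  then show ?thesis
    using s0(2) nonneg[OF s] by (simp add: mult_le_0_iff)
next
  case False
  let ?E = "\<lambda>s. N s * exp (C * s)"
  have "?E s \<le> ?E s0"
  proof (rule DERIV_nonneg_imp_nondecreasing[where f = ?E])
    fix x assume "s \<le> x" "x \<le> s0"
    then have x: "x \<in> {a..b}" using s0 s by auto
    have "(?E has_real_derivative (N' x + C * N x) * exp (C * x)) (at x)"
      by (auto intro!: derivative_eq_intros d[OF x] simp: algebra_simps)
    moreover have "0 \<le> (N' x + C * N x) * exp (C * x)"
      using bound[OF x] by (intro mult_nonneg_nonneg) auto
    ultimately show "\<exists>y. (?E has_real_derivative y) (at x) \<and> 0 \<le> y" by blast
  qed (use False in auto)
  then show ?thesis
    using s0(2) nonneg[OF s] by (simp add: mult_le_0_iff)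
qed

text \<open>
  A homogeneous linear first order system with continuous coefficients has only the zero solution
      with
  zero initial values: Gronwall's inequality applies to the sum of the squares of the components.
\<close>
lemma linear_ode_zero:
  fixes z :: "nat \<Rightarrow> real \<Rightarrow> real" and A :: "nat \<Rightarrow> nat \<Rightarrow> real \<Rightarrow> real"
  assumes d: "\<And>i s. i < k \<Longrightarrow> s \<in> {a..b} \<Longrightarrow> (z i has_real_derivative (\<Sum>j<k. A i j s * z j s)) (at s)"
    and A: "\<And>i j. i < k \<Longrightarrow> j < k \<Longrightarrow> continuous_on {a..b} (A i j)"
    and s0: "s0 \<in> {a..b}" "\<And>i. i < k \<Longrightarrow> z i s0 = 0" and s: "s \<in> {a..b}" and i: "i < k"
  shows "z i s = 0"
proof -
  define N where "N = (\<lambda>s. \<Sum>i<k. (z i s)\<^sup>2)"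
  define N' where "N' = (\<lambda>s. \<Sum>i<k. \<Sum>j<k. 2 * A i j s * z i s * z j s)"
  have "\<exists>M. \<forall>s\<in>{a..b}. \<bar>A i j s\<bar> \<le> M" if "i < k" "j < k" for i j
    using compact_imp_bounded[OF compact_continuous_image[OF A[OF that]]]
    by (auto simp: bounded_iff)
  then obtain M where M: "\<bar>A i j s\<bar> \<le> M i j" if "i < k" "j < k" "s \<in> {a..b}" for i j s
    by metis
  define C where "C = (\<Sum>i<k. \<Sum>j<k. 2 * M i j)"
  have dN: "(N has_real_derivative N' s) (at s)" if "s \<in> {a..b}" for s
    unfolding N_def N'_def
    by (auto intro!: derivative_eq_intros d that sum.cong simp: sum_distrib_left mult_ac)
  have bound: "\<bar>N' s\<bar> \<le> C * N s" if "s \<in> {a..b}" for s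
  proof -
    have "\<bar>2 * A i j s * z i s * z j s\<bar> \<le> 2 * M i j * N s" if ij: "i < k" "j < k" for i j
    proof -
      have le: "(z l s)\<^sup>2 \<le> N s" if "l < k" for l
        unfolding N_def using that by (intro member_le_sum) auto
      have "2 * \<bar>z i s * z j s\<bar> \<le> (z i s)\<^sup>2 + (z j s)\<^sup>2"
        using sum_squares_bound[of "\<bar>z i s\<bar>" "\<bar>z j s\<bar>"] by (simp add: abs_mult)
      then have "\<bar>z i s * z j s\<bar> \<le> N s"
        using le[OF ij(1)] le[OF ij(2)] by linarith
      then have "\<bar>A i j s\<bar> * \<bar>z i s * z j s\<bar> \<le> M i j * N s"
        using M[OF ij \<open>s \<in> {a..b}\<close>] by (intro mult_mono) auto
      then show ?thesis
        by (simp add: abs_mult)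
    qed
    then have "(\<Sum>i<k. \<Sum>j<k. \<bar>2 * A i j s * z i s * z j s\<bar>) \<le> (\<Sum>i<k. \<Sum>j<k. 2 * M i j * N s)"
      by (intro sum_mono) auto
    moreover have "\<bar>N' s\<bar> \<le> (\<Sum>i<k. \<Sum>j<k. \<bar>2 * A i j s * z i s * z j s\<bar>)"
      unfolding N'_def by (intro order_trans[OF sum_abs] sum_mono sum_abs)
    ultimately show ?thesis
      by (simp add: C_def sum_distrib_right)
  qed
  have "N s = 0"
    using dN bound _ s0(1) _ s
  proof (rule gronwall_zero)
    show "0 \<le> N s" for s
      unfolding N_def by (intro sum_nonneg) auto
    show "N s0 = 0"
      using s0(2) by (simp add: N_def)
  qed
  then show ?thesis
    using i by (simp add: N_def sum_nonneg_eq_0_iff)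
qed

text \<open>
  For \<open>F r = r ^ (2 * k + 1) * d r\<close> the functions \<open>F, D F, \<dots>, D\<^sup>k\<^sup>-\<^sup>1 F\<close> form a solution of a linear
  first order system. The last equation is solved for \<open>D\<^sup>k F\<close>, whose coefficient \<open>(1 - s) ^ k\<close> in
  \<open>L_op k F\<close> is nonzero.
\<close>
proposition L_op_ivp_unique:
  assumes "0 < a" and d: "C_k_on k {a<..<1} d" and s0: "s0 \<in> {a<..<1}" "vanishes_to_order k s0 d"
    and ode: "\<And>s. s \<in> {a<..<1} \<Longrightarrow> L_op k (\<lambda>r. r ^ (2 * k + 1) * d r) s = 0"
    and s: "s \<in> {a<..<1}"
  shows "d s = 0"
proof -
  let ?S = "{a<..<1}"
  have S: "open ?S" "0 \<notin> ?S"
    using \<open>0 < a\<close> by auto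
  define F where "F = (\<lambda>r. r ^ (2 * k + 1) * d r)"
  have pow: "C_k_on k ?S (\<lambda>r. r ^ (2 * k + 1))"
    by (intro C_k_on_power C_k_on_ident S)
  have F: "C_k_on k ?S F"
    unfolding F_def by (intro C_k_on_mult pow d S)
  have F0: "vanishes_to_order k s0 F"
    unfolding F_def by (rule vanishes_to_order_mult[OF S(1) s0(1) pow d s0(2)])
  define z where "z = (\<lambda>i. (D_op ^^ i) F)"
  have z0: "z i s0 = 0" if i: "i < k" for i
  proof -
    have "vanishes_to_order (k - i) s0 (z i)"
      unfolding z_def using F F0 i by (intro vanishes_to_order_D_op_funpow[OF S(1) s0(1) S(2)]) auto
    moreover obtain m where "k - i = Suc m"
      using i by (cases "k - i") auto
    ultimately show ?thesis
      by (simp add: vanishes_to_order_Suc)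
  qed
  have top: "(1 - u) ^ k * z k u = - (\<Sum>j<k. bessel_coeff k j * (1 - u) ^ j * z j u)" if "u \<in> ?S"
      for u
  proof -
    have "bessel_sum k (\<lambda>m. (1 - u) ^ m * z m u) = 0"
      using ode[OF that] by (simp add: L_op_conv_bessel_sum F_def z_def)
    then show ?thesis
      by (simp add: bessel_sum_def lessThan_Suc_atMost[symmetric] mult.assoc add_eq_0_iff2)
  qed
  show ?thesis
  proof (cases "k = 0")
    case True
    then show ?thesis
      using ode[OF s] s \<open>0 < a\<close> by (simp add: L_op_def)
  next
    case False
    \<comment> \<open>The companion matrix of the equation.\<close>
    define A :: "nat \<Rightarrow> nat \<Rightarrow> real \<Rightarrow> real" where
      "A = (\<lambda>i j u. if Suc i < k then (if j = Suc i then u else 0)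
        else - (u * bessel_coeff k j * (1 - u) ^ j / (1 - u) ^ k))"
    have dz: "(z i has_real_derivative (\<Sum>j<k. A i j u * z j u)) (at u)" if i: "i < k"
        and u: "u \<in> ?S" for i u
    proof -
      have "C_k_on (Suc 0) ?S (z i)"
        unfolding z_def using F i by (intro C_k_on_D_op_funpow[OF S]) (auto intro: C_k_on_le)
      from C_k_on_DERIV[OF this u] have "(z i has_real_derivative u * z (Suc i) u) (at u)"
        using u \<open>0 < a\<close> by (simp add: z_def D_op_def)
      moreover have "u * z (Suc i) u = (\<Sum>j<k. A i j u * z j u)"
      proof (cases "Suc i < k")
        case True
        then have "(\<Sum>j<k. A i j u * z j u) = (\<Sum>j<k. if j = Suc i then u * z j u else 0)"
          by (intro sum.cong) (auto simp: A_def)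
        then show ?thesis
          using True by simp
      next
        case False
        then have "Suc i = k"
          using i by simp
        have "(\<Sum>j<k. A i j u * z j u) =
            u * (- (\<Sum>j<k. bessel_coeff k j * (1 - u) ^ j * z j u)) / (1 - u) ^ k"
          using False by (simp add: A_def sum_distrib_left sum_divide_distrib sum_negf mult.assoc)
        also have "\<dots> = u * z k u"
          unfolding top[OF u, symmetric] using u by simp
        finally show ?thesis
          using \<open>Suc i = k\<close> by simp
      qed
      ultimately show ?thesis by simp
    qed
    let ?l = "min s s0" and ?u = "max s s0"
    have sub: "{?l..?u} \<subseteq> ?S"
      using s s0(1) by auto
    have "z 0 s = 0"
    proof (rule linear_ode_zero[of k ?l ?u z A s0 s 0])
      show "continuous_on {?l..?u} (A i j)" for i j
      proof -
        have "u \<noteq> 1" if "u \<in> {?l..?u}" for u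
          using subsetD[OF sub that] by simp
        then have "continuous_on {?l..?u} (\<lambda>u. -
            (u * bessel_coeff k j * (1 - u) ^ j / (1 - u) ^ k))"
          by (intro continuous_intros) auto
        then show ?thesis
          unfolding A_def by (cases "Suc i < k"; cases "j = Suc i") simp_all
      qed
    qed (use sub dz z0 False in auto)
    then show ?thesis
      using s \<open>0 < a\<close> by (simp add: z_def F_def)
  qed
qed

section \<open>Radial profiles of test functions\<close>

lemma C_k_along_axis:
  fixes f :: "'a::euclidean_space \<Rightarrow> real"
  assumes b: "b \<in> Basis"
  shows "C_k m f \<Longrightarrow> C_k_on m UNIV (\<lambda>r. f (r *\<^sub>R b))"
proof (induction m arbitrary: f)
  case 0
  then show ?case
    by (auto simp: C_k_on_0 intro!: continuous_on_compose2[of UNIV f] continuous_intros)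
next
  case (Suc m)
  have "((\<lambda>r. f (r *\<^sub>R b)) has_real_derivative frechet_derivative f (at (r *\<^sub>R b)) b) (at r)" for r
  proof -
    let ?f' = "frechet_derivative f (at (r *\<^sub>R b))"
    have f': "(f has_derivative ?f') (at (r *\<^sub>R b))"
      using Suc.prems by (simp add: differentiable_on_def frechet_derivative_works)
    have "((\<lambda>r. r *\<^sub>R b) has_derivative (\<lambda>h. h *\<^sub>R b)) (at r)"
      by (auto intro!: derivative_eq_intros)
    from has_derivative_compose[OF this f'] have
        "((\<lambda>r. f (r *\<^sub>R b)) has_derivative (\<lambda>h. ?f' (h *\<^sub>R b))) (at r)" .
    moreover have "?f' (h *\<^sub>R b) = ?f' b * h" for h
      using linear_scale[OF has_derivative_linear[OF f']] by simp
    ultimately show ?thesis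
      by (simp add: has_field_derivative_def)
  qed
  moreover have "C_k_on m UNIV (\<lambda>r. frechet_derivative f (at (r *\<^sub>R b)) b)"
    using Suc.prems b by (intro Suc.IH) simp
  ultimately show ?case
    by (intro C_k_on_Suc_if_derivative) auto
qed

lemma test_function_on_ball_bounds:
  fixes f :: "'a::euclidean_space \<Rightarrow> real"
  assumes "test_function_on (ball 0 1) f"
  obtains B \<rho> where "\<And>x. \<bar>f x\<bar> \<le> B" and "\<rho> < 1" and "\<And>x. norm x > \<rho> \<Longrightarrow> f x = 0"
proof -
  let ?K = "closure {x. f x \<noteq> 0}"
  have K: "compact ?K" "?K \<subseteq> ball 0 1" and cont: "continuous_on UNIV f"
    using assms by (auto simp: test_function_on_def dest: spec[of _ 0])
  have out: "f x = 0" if "x \<notin> ?K" for x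
    using that closure_subset[of "{x. f x \<noteq> 0}"] by blast
  obtain B where B: "\<And>x. x \<in> ?K \<Longrightarrow> \<bar>f x\<bar> \<le> B"
    using compact_imp_bounded[OF compact_continuous_image[OF continuous_on_subset[OF cont] K(1)]]
    by (auto simp: bounded_iff)
  have 1: "\<bar>f x\<bar> \<le> max B 0" for x
    using B[of x] out[of x] by (cases "x \<in> ?K") auto
  show thesis
  proof (cases "?K = {}")
    case True
    then have "f x = 0" for x
      using out[of x] by blast
    then show thesis
      using that[OF 1, of 0] by simp
  next
    case False
    then obtain y where y: "y \<in> ?K" "\<And>x. x \<in> ?K \<Longrightarrow> norm x \<le> norm y"
      using continuous_attains_sup[OF K(1) False continuous_on_norm[OF continuous_on_id]] by blast
    moreover have "norm y < 1"
      using K(2) y(1) by auto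
    moreover have "f x = 0" if "norm x > norm y" for x
    proof (rule out)
      show "x \<notin> ?K"
        using y(2)[of x] that by linarith
    qed
    ultimately show thesis
      using that[OF 1] by blast
  qed
qed

lemma funpow_deriv_zero:
  assumes "open T"
  shows "(\<And>x. x \<in> T \<Longrightarrow> g x = 0) \<Longrightarrow> x \<in> T \<Longrightarrow> (deriv ^^ i) g x = (0 :: real)"
proof (induction i arbitrary: x)
  case (Suc i)
  have "\<forall>\<^sub>F y in nhds x. (deriv ^^ i) g y = 0"
    using Suc assms by (auto simp: eventually_nhds intro!: exI[of _ T])
  then have "deriv ((deriv ^^ i) g) x = deriv (\<lambda>_. 0) x"
    by (rule deriv_cong_ev) simp
  then show ?case by simp
qed simp

text \<open>
  The \<open>i\<close>-th derivative is continuous at \<open>a\<close> and vanishes to the right of \<open>a\<close>, where the function is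
  zero on an open set.
\<close>
lemma funpow_deriv_zero_left_end:
  assumes "C_k_on i {b<..} g" "b < a" and zero: "\<And>x. x \<ge> a \<Longrightarrow> g x = 0"
  shows "(deriv ^^ i) g a = (0 :: real)"
proof -
  let ?u = "(deriv ^^ i) g"
  have "continuous_on {b<..} ?u"
    using assms(1) by (simp add: C_k_on_def)
  then have "isCont ?u a"
    using assms(2) by (simp add: continuous_on_eq_continuous_at)
  then have "(?u \<longlongrightarrow> ?u a) (at_right a)"
    by (simp add: isCont_def filterlim_at_split)
  moreover have "\<forall>\<^sub>F x in at_right a. ?u x = 0"
    using zero by (intro eventually_at_rightI[of a "a + 1"] funpow_deriv_zero[of "{a<..}"]) auto
  then have "(?u \<longlongrightarrow> 0) (at_right a)"
    by (rule tendsto_eventually)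
  ultimately show ?thesis
    by (rule tendsto_unique[OF trivial_limit_at_right_real])
qed

section \<open>Recovery of a radial function from its spherical means\<close>

theorem theorem3p3:
  fixes f :: "real ^ 'n \<Rightarrow> real" and \<phi> h :: "real \<Rightarrow> real"
    and n k :: nat and \<epsilon> :: real and p :: "real ^ 'n"
  assumes "0 < \<epsilon>" and "\<epsilon> < 1"
    and "n = CARD('n)" and "n \<ge> 3" and "odd n" and "k = (n - 3) div 2"
    and "test_function_on (ball 0 1) f"
    and "\<And>x. f x = \<phi> (norm x)"
    and "p \<in> sphere 0 1"
    and "\<And>t. t \<in> {0<..<1} \<Longrightarrow>
           h t = 4 ^ k * sphere_area (2 * k + 3) * t ^ (2 * k + 1) / sphere_area (2 * k + 2) *
                   spherical_mean f p t"
  shows "C_k_on (2 * k + 1) {0<..<1 - \<epsilon>} h \<and>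
    (\<exists>\<epsilon>'>0. 1 - \<epsilon>' > \<epsilon> \<and> (\<forall>r\<ge>1 - \<epsilon>'. \<phi> r = 0)) \<and>
    (\<forall>\<epsilon>'>0. 1 - \<epsilon>' > \<epsilon> \<and> (\<forall>r\<ge>1 - \<epsilon>'. \<phi> r = 0) \<longrightarrow>
       solves_ivp k h \<epsilon> \<epsilon>' \<phi> \<and>
       (\<forall>g. solves_ivp k h \<epsilon> \<epsilon>' g \<longrightarrow> (\<forall>r\<in>{\<epsilon><..<1}. g r = \<phi> r)))"
proof -
  have card: "CARD('n) = 2 * k + 3"
    using assms(3-6) by (auto elim!: oddE)
  have p: "norm p = 1"
    using assms(9) by simp
  have f_smooth: "C_k m f" for m
    using assms(7) by (simp add: test_function_on_def)
  obtain B \<rho> where B: "\<And>x. \<bar>f x\<bar> \<le> B" and \<rho>: "\<rho> < 1" "\<And>x. norm x > \<rho> \<Longrightarrow> f x = 0"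
    using test_function_on_ball_bounds[OF assms(7)] by metis
  \<comment> \<open>Any coordinate direction serves to express the profile through \<open>f\<close>.\<close>
  define b :: "real ^ 'n" where "b = axis undefined 1"
  have b: "b \<in> Basis" "norm b = 1"
    by (simp_all add: b_def axis_in_Basis_iff)
  have \<phi>_eq: "\<phi> r = f (r *\<^sub>R b)" if "r \<ge> 0" for r
    using that b(2) by (simp add: assms(8))
  have \<phi>_smooth: "smooth_on {0<..} \<phi>"
  proof
    fix m
    have "C_k_on m {0<..} (\<lambda>r. f (r *\<^sub>R b))"
      using C_k_along_axis[OF b(1) f_smooth] by (rule C_k_on_subset) simp
    then show "C_k_on m {0<..} \<phi>"
      using C_k_on_cong[of "{0<..}" \<phi>] \<phi>_eq by simp
  qed
  have \<phi>_0: "\<phi> r = 0" if "r > max \<rho> 0" for r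
    using that \<rho>(2)[of "r *\<^sub>R b"] b(2) by (simp add: \<phi>_eq)
  define q where "q = (\<lambda>r. r * \<phi> r)"
  have q: "smooth_on {0<..} q"
    unfolding q_def using \<phi>_smooth by (auto intro: C_k_on_mult)
  have h: "h t = kernel_integral k q t" if t: "t \<in> {0<..<1}" for t
    unfolding assms(10)[OF t] q_def
    using f_smooth[of 0] \<phi>_smooth \<phi>_0 \<rho>(1) C_k_on_continuous
    by (intro spherical_mean_radial_conv_kernel_integral[where \<phi> =
        \<phi>, OF p card _ B assms(8) _ _ t]) auto
  let ?S = "{\<epsilon><..<1}" and ?c = "\<lambda>t. (-1) ^ k * fact k * 2 ^ (3 * k) / t ^ (2 * k) :: real"
  let ?L = "\<lambda>g. L_op k (\<lambda>r. r ^ (2 * k + 1) * g r)"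
  have S: "open ?S" "0 \<notin> ?S"
    using assms(1) by auto
  have ode: "deriv ((D_op ^^ (2 * k)) h) t = ?c t * ?L \<phi> (1 - t)" if t: "t \<in> {0<..<1}" for t
  proof -
    have "deriv ((D_op ^^ (2 * k)) h) t = t * (D_op ^^ (2 * k + 1)) h t"
      using t by (simp add: D_op_def)
    also have "(D_op ^^ (2 * k + 1)) h t = (D_op ^^ (2 * k + 1)) (kernel_integral k q) t"
      using t h by (intro D_op_funpow_cong[of "{0<..<1}"]) auto
    also have "\<dots> = (-1) ^ k * fact k * 8 ^ k * scaled_L k (\<lambda>r. r ^ (2 * k) * q r) t"
      by (rule D_op_funpow_kernel_integral[OF q t])
    also have "(\<lambda>r. r ^ (2 * k) * q r) = (\<lambda>r. r ^ (2 * k + 1) * \<phi> r)"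
      by (simp add: q_def mult_ac)
    also have "t * ((-1) ^ k * fact k * 8 ^ k * scaled_L k (\<lambda>r. r ^ (2 * k + 1) * \<phi> r) t) =
        ?c t * ?L \<phi> (1 - t)"
      using t by (simp add: scaled_L_def power_mult)
    finally show ?thesis .
  qed
  show ?thesis
  proof (intro conjI allI impI ballI)
    have "C_k_on (2 * k + 1) {0<..<1 - \<epsilon>} (kernel_integral k q)"
      by (rule C_k_on_subset[of _ "{0<..<1}"]) (use smooth_on_kernel_integral[OF q] assms(1)
          in auto)
    moreover have "h t = kernel_integral k q t" if "t \<in> {0<..<1 - \<epsilon>}" for t
      using that assms(1) by (intro h) auto
    ultimately show "C_k_on (2 * k + 1) {0<..<1 - \<epsilon>} h"
      using C_k_on_cong[OF open_greaterThanLessThan] by blast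
  next
    \<comment> \<open>Half of the distance from \<open>max \<rho> \<epsilon>\<close> to \<open>1\<close>.\<close>
    define \<epsilon>' where "\<epsilon>' = (1 - max \<rho> \<epsilon>) / 2"
    have "\<epsilon>' > 0" "1 - \<epsilon>' > \<epsilon>" "1 - \<epsilon>' > \<rho>"
      using \<rho>(1) assms(2) by (auto simp: \<epsilon>'_def field_simps max_def)
    then show "\<exists>\<epsilon>'>0. 1 - \<epsilon>' > \<epsilon> \<and> (\<forall>r\<ge>1 - \<epsilon>'. \<phi> r = 0)"
      using \<phi>_0 assms(1) by (intro exI[of _ \<epsilon>']) auto
  next
    fix \<epsilon>' :: real assume \<epsilon>': "\<epsilon>' > 0" "1 - \<epsilon>' > \<epsilon> \<and> (\<forall>r\<ge>1 - \<epsilon>'. \<phi> r = 0)"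
    then have s0: "1 - \<epsilon>' \<in> ?S" by simp
    have \<phi>_S: "smooth_on ?S \<phi>"
      using \<phi>_smooth assms(1) by (auto intro: C_k_on_subset)
    have init: "(deriv ^^ i) \<phi> (1 - \<epsilon>') = 0" for i
      using \<phi>_smooth \<epsilon>' assms(1) by (intro funpow_deriv_zero_left_end[of i 0]) auto
    show "solves_ivp k h \<epsilon> \<epsilon>' \<phi>"
      unfolding solves_ivp_def using \<phi>_S init ode assms(1) by auto
    fix g r assume g: "solves_ivp k h \<epsilon> \<epsilon>' g" and r: "r \<in> ?S"
    have g_S: "C_k_on k ?S g"
      using g by (simp add: solves_ivp_def)
    have pow: "C_k_on k ?S (\<lambda>r. r ^ (2 * k + 1))"
      by (intro C_k_on_power C_k_on_ident S)
    have "g r - \<phi> r = 0"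
    proof (rule L_op_ivp_unique[OF assms(1) _ s0 _ _ r])
      show "C_k_on k ?S (\<lambda>r. g r - \<phi> r)"
        using \<phi>_S g_S by (intro C_k_on_diff) auto
      have "vanishes_to_order k (1 - \<epsilon>') (\<lambda>r. g r + (-1) * \<phi> r)"
        using g init \<phi>_S g_S S(1)
        by (intro vanishes_to_order_add[OF S(1) s0] vanishes_to_order_mult[OF S(1) s0] C_k_on_mult)
          (auto simp: vanishes_to_order_def solves_ivp_def)
      then show "vanishes_to_order k (1 - \<epsilon>') (\<lambda>r. g r - \<phi> r)"
        by simp
      fix s assume s: "s \<in> ?S"
      have "?L g s = ?L \<phi> s"
      proof -
        have t: "1 - s \<in> {0<..<1 - \<epsilon>}" "1 - s \<in> {0<..<1}"
          using s assms(1) by auto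
        have "deriv ((D_op ^^ (2 * k)) h) (1 - s) = ?c (1 - s) * ?L g (1 - (1 - s))"
          using g t(1) unfolding solves_ivp_def by blast
        with ode[OF t(2)]
        have "?c (1 - s) * ?L g (1 - (1 - s)) = ?c (1 - s) * ?L \<phi> (1 - (1 - s))"
          by (simp only:)
        moreover have "?c (1 - s) \<noteq> 0"
          using s by simp
        ultimately show ?thesis
          by (simp only: mult_cancel_left) simp
      qed
      moreover have "L_op k (\<lambda>r. r ^ (2 * k + 1) * g r - r ^ (2 * k + 1) * \<phi> r) s = ?L g s - ?L \<phi> s"
        using \<phi>_S g_S s by (intro L_op_diff[OF S] C_k_on_mult pow S) auto
      ultimately show "?L (\<lambda>r. g r - \<phi> r) s = 0"
        by (simp add: right_diff_distrib)
    qed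
    then show "g r = \<phi> r" by simp
  qed
qed

end
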